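(* Let $R$ be a commutative unital ring, $n\ge 1$, $A=\Lambda[x_1,\ldots,x_n]$ the exterior algebra over $R$, and $A^e=A\otimes_R A^{\mathrm{op}}$. Let $B_\ast$ be the (normalized) bar resolution of $A$, let $\mathcal{M}$ be the Morse matching on $B_\ast$ described in the context, and let $\mathring{B}_\ast$ be the resulting Morse complex, with free $A^e$-basis $\{x_{(\tau)}\}$ in degree $k$ indexed by the $k$-element multisubsets $\tau$ of $[n]$. Then the homotopy equivalence $h:\mathring{B}_\ast\to B_\ast$ of complexes of $A^e$-modules induced by $\mathcal{M}$ and its homotopy inverse $h^{-1}:B_\ast\to\mathring{B}_\ast$ induced by $\mathcal{M}$ satisfy, for every multiset $\tau=\{i_1\le\cdots\le i_k\}$ of elements of $[n]$, $$h(x_{(\tau)})=\sum_{(j_1,\ldots,j_k)} 1\otimes x_{j_1}\otimes\cdots\otimes x_{j_k}\otimes 1,$$ where the sum runs over all distinct rearrangements $(j_1,\ldots,j_k)$ of the sequence $(i_1,\ldots,i_k)$ (each distinct sequence occurring exactly once), and, for every rearrangement $(j_1,\ldots,j_k)$ of $(i_1,\ldots,i_k)$, $$h^{-1}(1\otimes x_{j_1}\otimes\cdots\otimes x_{j_k}\otimes 1)=\begin{cases}x_{(\tau)} & \text{if }(j_1,\ldots,j_k)=(i_1,\ldots,i_k),\\ 0&\text{otherwise.}\end{cases}$$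
   Context: Notation: $[n]=\{1,\ldots,n\}$; $x_\sigma=\bigwedge_{i\in\sigma}x_i$ (increasing order) for $\sigma\subseteq[n]$, an $R$-basis of $A$, with $x_i^2=0$, $x_ix_j=-x_jx_i$. A multiset $\tau$ is identified with its increasing sequence $i_1\le\cdots\le i_k$. Bar resolution: $B_k=A^{\otimes k+2}$ for $k\ge0$ (tensors over $R$), with $A^e$ acting by $(\alpha\otimes\beta)(a_0\otimes\cdots\otimes a_{k+1})=(\alpha a_0)\otimes a_1\otimes\cdots\otimes a_k\otimes(a_{k+1}\beta)$ and $b_k(a_0\otimes\cdots\otimes a_{k+1})=\sum_{i=0}^k(-1)^i a_0\otimes\cdots\otimes a_ia_{i+1}\otimes\cdots\otimes a_{k+1}$. Its normalized version, used here, has free $A^e$-basis $\{1\otimes x_{\sigma_1}\otimes\cdots\otimes x_{\sigma_k}\otimes1\}$ with all $\sigma_j\subseteq[n]$ nonempty. Digraph and matching: $\Gamma$ is the weighted digraph whose vertices are these basis elements, with an edge $v\to v'$ of weight $w\in A^e$ whenever $v'$ occurs in $b(v)$ with nonzero coefficient $w$. $\mathcal{M}$ is the set of all edges $$1\otimes x_{i_1}\otimes\cdots\otimes x_{i_{r-1}}\otimes x_i\otimes x_{\sigma_r\setminus\{i\}}\otimes x_{\sigma_{r+1}}\otimes\cdots\otimes x_{\sigma_k}\otimes1\;\longrightarrow\;1\otimes x_{i_1}\otimes\cdots\otimes x_{i_{r-1}}\otimes x_{\sigma_r}\otimes x_{\sigma_{r+1}}\otimes\cdots\otimes x_{\sigma_k}\otimes1$$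 with $r\ge1$, $|\sigma_r|\ge2$ and $i_1\le\cdots\le i_{r-1}\le i=\max\sigma_r$. Each such edge has weight $\pm1$. $\Gamma^{\mathcal{M}}$ is obtained from $\Gamma$ by reversing every edge in $\mathcal{M}$ and replacing its weight $w$ by $-w^{-1}$. The weight of a directed path is the product of the weights of its edges, taken in the order they are traversed from left to right; the path of length $0$ has weight $1$. Morse complex: the vertices not incident to an edge of $\mathcal{M}$ (critical vertices) are exactly $x_{(\tau)}:=1\otimes x_{i_1}\otimes\cdots\otimes x_{i_k}\otimes1$ with $\tau=\{i_1\le\cdots\le i_k\}$. $\mathring{B}_k$ is the free $A^e$-module on the critical vertices of degree $k$, where the boundary $\mathring{b}_k(x_{(\tau)})$ is $\sum_{\tau'}(\text{sum of weights of all directed paths in }\Gamma^{\mathcal{M}}\text{ from }x_{(\tau)}\text{ to }x_{(\tau')})\,x_{(\tau')}$ over critical vertices of degree $k-1$; explicitly, $\mathring{b}_k(x_{(\tau)})=\sum_{i\in\overline{\tau}}(x_i\otimes1+(-1)^k1\otimes x_i)x_{(\tau\setminus\{i\})}$, with $\overline{\tau}$ the underlying set of $\tau$ and $\tau\setminus\{i\}$ being $\tau$ with one copy of $i$ removed. Induced maps: $h$ and $h^{-1}$ are the $A^e$-linear maps such that, in each degree $k$, $h(x_{(\tau)})=\sum_v\alpha_v v$, with $v$ over all basis elements of $B_k$ and $\alpha_v$ the sum of weights of all directed paths in $\Gamma^{\mathcal{M}}$ from $x_{(\tau)}$ to $v$; and $h^{-1}(v)=\sum_\tau\alpha_\tau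 x_{(\tau)}$, with $\alpha_\tau$ the sum of weights of all directed paths in $\Gamma^{\mathcal{M}}$ from $v$ to the critical vertex $x_{(\tau)}$ of degree $k$. ($h^{-1}$ denotes a homotopy inverse, not a strict inverse.) *)

theory Defs
  imports
    "HOL-Library.Poly_Mapping"
    "HOL-Library.Multiset"
    "HOL-Combinatorics.Multiset_Permutations"
begin

text \<open>
  The index set \<open>[n] = {1, ..., n}\<close> is rendered as a type \<open>'n\<close> of sort \<open>{finite, linorder}\<close>, so that
  \<open>n\<close> is \<open>CARD('n) \<ge> 1\<close>. The ground ring \<open>R\<close> is a type \<open>'r\<close> of class \<open>comm_ring_1\<close>.
\<close>

section \<open>Algebras with a basis that is closed under multiplication up to scalars\<close>

definition twisted_mult ::
  "('i::finite \<Rightarrow> 'i \<Rightarrow> 'i) \<Rightarrow> ('i \<Rightarrow> 'i \<Rightarrow> 'r::comm_ring_1) \<Rightarrow> ('i \<Rightarrow> 'r) \<Rightarrow> ('i \<Rightarrow> 'r) \<Rightarrow> 'i \<Rightarrow> 'r"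
  where "twisted_mult m s a b z = (\<Sum>x\<in>UNIV. \<Sum>y\<in>UNIV. if m x y = z then s x y * a x * b y else 0)"

lemma twisted_mult_assoc:
  fixes s :: "'i::finite \<Rightarrow> 'i \<Rightarrow> 'r::comm_ring_1"
  assumes m: "\<And>x y z. m (m x y) z = m x (m y z)"
    and s: "\<And>x y z. s x y * s (m x y) z = s x (m y z) * s y z"
  shows "twisted_mult m s (twisted_mult m s a b) c = twisted_mult m s a (twisted_mult m s b c)"
proof
  fix t
  have L: "(if m w z = t then s w z * (if m x y = w then s x y * a x * b y else 0) * c z else 0) =
     (if w = m x y then (if m (m x y) z = t then s x y * s (m x y) z * a x * b y * c z else 0) else 0)"
    for w x y z by (auto simp: ac_simps)
  have R: "(if m x w = t then s x w * a x * (if m y z = w then s y z * b y * c z else 0) else 0) =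
     (if w = m y z then (if m x (m y z) = t then s x (m y z) * s y z * a x * b y * c z else 0) else 0)"
    for w x y z by (auto simp: ac_simps)
  have "twisted_mult m s (twisted_mult m s a b) c t =
    (\<Sum>w\<in>UNIV. \<Sum>z\<in>UNIV. \<Sum>x\<in>UNIV. \<Sum>y\<in>UNIV.
       if m w z = t then s w z * (if m x y = w then s x y * a x * b y else 0) * c z else 0)"
    unfolding twisted_mult_def
    by (intro sum.cong refl) (auto simp: sum_distrib_left sum_distrib_right)
  also have "\<dots> = (\<Sum>w\<in>UNIV. \<Sum>z\<in>UNIV. \<Sum>x\<in>UNIV. \<Sum>y\<in>UNIV.
       if w = m x y then (if m (m x y) z = t then s x y * s (m x y) z * a x * b y * c z else 0) else 0)"
    unfolding L ..
  also have "\<dots> = (\<Sum>z\<in>UNIV. \<Sum>w\<in>UNIV. \<Sum>x\<in>UNIV. \<Sum>y\<in>UNIV.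
       if w = m x y then (if m (m x y) z = t then s x y * s (m x y) z * a x * b y * c z else 0) else 0)"
    by (rule sum.swap)
  also have "\<dots> = (\<Sum>z\<in>UNIV. \<Sum>x\<in>UNIV. \<Sum>w\<in>UNIV. \<Sum>y\<in>UNIV.
       if w = m x y then (if m (m x y) z = t then s x y * s (m x y) z * a x * b y * c z else 0) else 0)"
    by (rule sum.cong[OF refl], rule sum.swap)
  also have "\<dots> = (\<Sum>z\<in>UNIV. \<Sum>x\<in>UNIV. \<Sum>y\<in>UNIV. \<Sum>w\<in>UNIV.
       if w = m x y then (if m (m x y) z = t then s x y * s (m x y) z * a x * b y * c z else 0) else 0)"
    by (rule sum.cong[OF refl], rule sum.cong[OF refl], rule sum.swap)
  also have "\<dots> = (\<Sum>z\<in>UNIV. \<Sum>x\<in>UNIV. \<Sum>y\<in>UNIV.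
       if m (m x y) z = t then s x y * s (m x y) z * a x * b y * c z else 0)"
    by (simp add: sum.delta)
  also have "\<dots> = (\<Sum>x\<in>UNIV. \<Sum>z\<in>UNIV. \<Sum>y\<in>UNIV.
       if m x (m y z) = t then s x (m y z) * s y z * a x * b y * c z else 0)"
    unfolding m s by (rule sum.swap)
  also have "\<dots> = (\<Sum>x\<in>UNIV. \<Sum>y\<in>UNIV. \<Sum>z\<in>UNIV. \<Sum>w\<in>UNIV.
       if w = m y z then (if m x (m y z) = t then s x (m y z) * s y z * a x * b y * c z else 0) else 0)"
    by (rule sum.cong[OF refl], subst sum.swap, simp add: sum.delta)
  also have "\<dots> = (\<Sum>x\<in>UNIV. \<Sum>y\<in>UNIV. \<Sum>w\<in>UNIV. \<Sum>z\<in>UNIV.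
       if w = m y z then (if m x (m y z) = t then s x (m y z) * s y z * a x * b y * c z else 0) else 0)"
    by (rule sum.cong[OF refl], rule sum.cong[OF refl], rule sum.swap)
  also have "\<dots> = (\<Sum>x\<in>UNIV. \<Sum>w\<in>UNIV. \<Sum>y\<in>UNIV. \<Sum>z\<in>UNIV.
       if w = m y z then (if m x (m y z) = t then s x (m y z) * s y z * a x * b y * c z else 0) else 0)"
    by (rule sum.cong[OF refl], rule sum.swap)
  also have "\<dots> = (\<Sum>x\<in>UNIV. \<Sum>w\<in>UNIV. \<Sum>y\<in>UNIV. \<Sum>z\<in>UNIV.
       if m x w = t then s x w * a x * (if m y z = w then s y z * b y * c z else 0) else 0)"
    unfolding R ..
  also have "\<dots> = twisted_mult m s a (twisted_mult m s b c) t"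
    unfolding twisted_mult_def
    by (intro sum.cong refl) (auto simp: sum_distrib_left)
  finally show "twisted_mult m s (twisted_mult m s a b) c t =
    twisted_mult m s a (twisted_mult m s b c) t" .
qed

lemma twisted_mult_unit_left:
  assumes "\<And>x. m e x = x" "\<And>x. s e x = 1"
  shows "twisted_mult m s (\<lambda>x. if x = e then 1 else 0) a = a"
proof
  fix z
  have "twisted_mult m s (\<lambda>x. if x = e then 1 else 0) a z =
    (\<Sum>x\<in>UNIV. if x = e then (\<Sum>y\<in>UNIV. if y = z then a y else 0) else 0)"
    unfolding twisted_mult_def using assms by (intro sum.cong) (auto intro!: sum.cong sum.neutral)
  then show "twisted_mult m s (\<lambda>x. if x = e then 1 else 0) a z = a z" by simp
qed

lemma twisted_mult_unit_right:
  assumes "\<And>x. m x e = x" "\<And>x. s x e = 1"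
  shows "twisted_mult m s a (\<lambda>x. if x = e then 1 else 0) = a"
proof
  fix z
  have "twisted_mult m s a (\<lambda>x. if x = e then 1 else 0) z =
    (\<Sum>x\<in>UNIV. \<Sum>y\<in>UNIV. if y = e then (if x = z then a x else 0) else 0)"
    unfolding twisted_mult_def using assms by (intro sum.cong refl) auto
  then show "twisted_mult m s a (\<lambda>x. if x = e then 1 else 0) z = a z" by simp
qed

lemma twisted_mult_distrib:
  "twisted_mult m s (\<lambda>x. a x + b x) c = (\<lambda>z. twisted_mult m s a c z + twisted_mult m s b c z)"
  "twisted_mult m s a (\<lambda>x. b x + c x) = (\<lambda>z. twisted_mult m s a b z + twisted_mult m s a c z)"
  unfolding twisted_mult_def
  by (auto intro!: sum.cong simp: fun_eq_iff sum.distrib[symmetric] algebra_simps)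

lemma twisted_mult_basis:
  fixes s :: "'i::finite \<Rightarrow> 'i \<Rightarrow> 'r::comm_ring_1"
  shows "twisted_mult m s (\<lambda>x. if x = u then 1 else 0) (\<lambda>x. if x = v then 1 else 0) =
    (\<lambda>z. if z = m u v then s u v else 0)"
proof
  fix z
  have "twisted_mult m s (\<lambda>x. if x = u then 1 else 0) (\<lambda>x. if x = v then 1 else 0) z =
    (\<Sum>x\<in>UNIV. \<Sum>y\<in>UNIV. if y = v then (if x = u then (if z = m u v then s u v else 0) else 0) else 0)"
    unfolding twisted_mult_def by (intro sum.cong refl) auto
  then show "twisted_mult m s (\<lambda>x. if x = u then 1 else 0) (\<lambda>x. if x = v then 1 else 0) z =
    (if z = m u v then s u v else 0)" by simp
qed


section \<open>The exterior algebra \<open>A\<close>\<close>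

text \<open>The scalar \<open>c\<close> with \<open>x\<^sub>\<sigma> x\<^sub>\<tau> = c x\<^bsub>\<sigma> \<union> \<tau>\<^esub>\<close>: zero if a variable is repeated, and otherwise the
  sign of the permutation that sorts the concatenation of the increasing sequences.\<close>

definition ext_sign :: "'n::linorder set \<Rightarrow> 'n set \<Rightarrow> 'r::comm_ring_1"
  where "ext_sign \<sigma> \<tau> =
    (if \<sigma> \<inter> \<tau> = {} then (- 1) ^ card {(i, j). i \<in> \<sigma> \<and> j \<in> \<tau> \<and> j < i} else 0)"

lemma ext_sign_empty [simp]: "ext_sign {} \<tau> = 1" "ext_sign \<sigma> {} = 1"
  by (simp_all add: ext_sign_def)

lemma ext_sign_union_left:
  fixes \<sigma> :: "'n::{finite,linorder} set"
  assumes "\<sigma> \<inter> \<tau> = {}"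
  shows "ext_sign (\<sigma> \<union> \<tau>) \<rho> = (ext_sign \<sigma> \<rho> * ext_sign \<tau> \<rho> :: 'r::comm_ring_1)"
proof -
  have "{(i, j). i \<in> \<sigma> \<union> \<tau> \<and> j \<in> \<rho> \<and> j < i} =
      {(i, j). i \<in> \<sigma> \<and> j \<in> \<rho> \<and> j < i} \<union> {(i, j). i \<in> \<tau> \<and> j \<in> \<rho> \<and> j < i}" by auto
  moreover have "{(i, j). i \<in> \<sigma> \<and> j \<in> \<rho> \<and> j < i} \<inter> {(i, j). i \<in> \<tau> \<and> j \<in> \<rho> \<and> j < i} = {}"
    using assms by auto
  ultimately have "card {(i, j). i \<in> \<sigma> \<union> \<tau> \<and> j \<in> \<rho> \<and> j < i} =
      card {(i, j). i \<in> \<sigma> \<and> j \<in> \<rho> \<and> j < i} + card {(i, j). i \<in> \<tau> \<and> j \<in> \<rho> \<and> j < i}"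
    by (simp add: card_Un_disjoint)
  then show ?thesis by (auto simp: ext_sign_def power_add Int_Un_distrib2)
qed

lemma ext_sign_union_right:
  fixes \<sigma> :: "'n::{finite,linorder} set"
  assumes "\<tau> \<inter> \<rho> = {}"
  shows "ext_sign \<sigma> (\<tau> \<union> \<rho>) = (ext_sign \<sigma> \<tau> * ext_sign \<sigma> \<rho> :: 'r::comm_ring_1)"
proof -
  have "{(i, j). i \<in> \<sigma> \<and> j \<in> \<tau> \<union> \<rho> \<and> j < i} =
      {(i, j). i \<in> \<sigma> \<and> j \<in> \<tau> \<and> j < i} \<union> {(i, j). i \<in> \<sigma> \<and> j \<in> \<rho> \<and> j < i}" by auto
  moreover have "{(i, j). i \<in> \<sigma> \<and> j \<in> \<tau> \<and> j < i} \<inter> {(i, j). i \<in> \<sigma> \<and> j \<in> \<rho> \<and> j < i} = {}"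
    using assms by auto
  ultimately have "card {(i, j). i \<in> \<sigma> \<and> j \<in> \<tau> \<union> \<rho> \<and> j < i} =
      card {(i, j). i \<in> \<sigma> \<and> j \<in> \<tau> \<and> j < i} + card {(i, j). i \<in> \<sigma> \<and> j \<in> \<rho> \<and> j < i}"
    by (simp add: card_Un_disjoint)
  then show ?thesis by (auto simp: ext_sign_def power_add Int_Un_distrib)
qed

lemma ext_sign_cocycle:
  fixes \<sigma> :: "'n::{finite,linorder} set"
  shows "ext_sign \<sigma> \<tau> * ext_sign (\<sigma> \<union> \<tau>) \<rho> = (ext_sign \<sigma> (\<tau> \<union> \<rho>) * ext_sign \<tau> \<rho> :: 'r::comm_ring_1)"
proof (cases "\<sigma> \<inter> \<tau> = {} \<and> \<tau> \<inter> \<rho> = {}")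
  case True
  then show ?thesis by (simp add: ext_sign_union_left ext_sign_union_right mult.assoc)
next
  case False
  then show ?thesis by (auto simp: ext_sign_def Int_Un_distrib Int_Un_distrib2)
qed

typedef (overloaded) ('n, 'r) ext = "UNIV :: ('n::{finite,linorder} set \<Rightarrow> 'r::comm_ring_1) set"
  morphisms ext_coeff Abs_ext ..

setup_lifting type_definition_ext

instantiation ext :: ("{finite,linorder}", comm_ring_1) ring_1
begin

lift_definition zero_ext :: "('a, 'b) ext" is "\<lambda>_. 0" .
lift_definition one_ext :: "('a, 'b) ext" is "\<lambda>\<sigma>. if \<sigma> = {} then 1 else 0" .
lift_definition plus_ext :: "('a, 'b) ext \<Rightarrow> ('a, 'b) ext \<Rightarrow> ('a, 'b) ext" is "\<lambda>a b \<sigma>. a \<sigma> + b \<sigma>" .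
lift_definition minus_ext :: "('a, 'b) ext \<Rightarrow> ('a, 'b) ext \<Rightarrow> ('a, 'b) ext" is "\<lambda>a b \<sigma>. a \<sigma> - b \<sigma>" .
lift_definition uminus_ext :: "('a, 'b) ext \<Rightarrow> ('a, 'b) ext" is "\<lambda>a \<sigma>. - a \<sigma>" .
lift_definition times_ext :: "('a, 'b) ext \<Rightarrow> ('a, 'b) ext \<Rightarrow> ('a, 'b) ext"
  is "twisted_mult (\<union>) ext_sign" .

instance
proof
  fix a b c :: "('a, 'b) ext"
  show "a + b + c = a + (b + c)" by transfer (simp add: add.assoc)
  show "a + b = b + a" by transfer (simp add: add.commute)
  show "0 + a = a" by transfer simp
  show "- a + a = 0" by transfer simp
  show "a - b = a + - b" by transfer simp
  show "a * b * c = a * (b * c)"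
    by transfer (rule twisted_mult_assoc, simp_all add: Un_assoc ext_sign_cocycle)
  show "1 * a = a" by transfer (rule twisted_mult_unit_left, simp_all)
  show "a * 1 = a" by transfer (rule twisted_mult_unit_right, simp_all)
  show "(a + b) * c = a * c + b * c" by transfer (rule twisted_mult_distrib)
  show "a * (b + c) = a * b + a * c" by transfer (rule twisted_mult_distrib)
  show "(0 :: ('a, 'b) ext) \<noteq> 1" by transfer (auto simp: fun_eq_iff)
qed

end

lift_definition ext_basis :: "'n::{finite,linorder} set \<Rightarrow> ('n, 'r::comm_ring_1) ext"
  is "\<lambda>\<sigma> \<rho>. if \<rho> = \<sigma> then 1 else 0" .

abbreviation ext_gen :: "'n::{finite,linorder} \<Rightarrow> ('n, 'r::comm_ring_1) ext"
  where "ext_gen i \<equiv> ext_basis {i}"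

lemma ext_coeff_basis: "ext_coeff (ext_basis \<sigma>) \<rho> = (if \<rho> = \<sigma> then 1 else 0)"
  by transfer simp

lemma ext_basis_empty: "ext_basis {} = 1"
  by transfer simp

lemma ext_coeff_basis_mult_basis:
  "ext_coeff (ext_basis \<sigma> * ext_basis \<tau>) \<rho> = (if \<rho> = \<sigma> \<union> \<tau> then ext_sign \<sigma> \<tau> else 0)"
  by transfer (simp add: twisted_mult_basis)

lemma ext_gen_square: "ext_gen i * ext_gen i = (0 :: ('n::{finite,linorder}, 'r::comm_ring_1) ext)"
proof -
  have "ext_coeff (ext_gen i * ext_gen i :: ('n, 'r) ext) = ext_coeff 0"
    by (auto simp: fun_eq_iff ext_coeff_basis_mult_basis ext_sign_def zero_ext.rep_eq)
  then show ?thesis by (simp add: ext_coeff_inject)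
qed

lemma ext_sign_singletons:
  "ext_sign {i} {j} = (if i = j then 0 else if j < i then - 1 else 1 :: 'r::comm_ring_1)"
proof -
  have "{(i', j'). i' \<in> {i} \<and> j' \<in> {j} \<and> j' < i'} = (if j < i then {(i, j)} else {})" by auto
  then show ?thesis unfolding ext_sign_def by (auto split: if_splits)
qed

lemma ext_gen_anticommute:
  "ext_gen i * ext_gen j = - (ext_gen j * ext_gen i :: ('n::{finite,linorder}, 'r::comm_ring_1) ext)"
proof -
  have "ext_coeff (ext_gen i * ext_gen j :: ('n, 'r) ext) =
      ext_coeff (- (ext_gen j * ext_gen i))"
    by (auto simp: fun_eq_iff ext_coeff_basis_mult_basis ext_sign_singletons uminus_ext.rep_eq
        insert_commute)
  then show ?thesis by (simp add: ext_coeff_inject)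
qed

lemma prod_list_ext_gen:
  fixes \<sigma> :: "'n::{finite,linorder} set"
  shows "prod_list (map ext_gen (sorted_list_of_set \<sigma>)) = (ext_basis \<sigma> :: ('n, 'r::comm_ring_1) ext)"
proof -
  have "prod_list (map ext_gen xs) = (ext_basis (set xs) :: ('n, 'r) ext)"
    if "sorted_wrt (<) xs" for xs :: "'n list"
    using that
  proof (induction xs)
    case Nil
    then show ?case by (simp add: ext_basis_empty)
  next
    case (Cons x xs)
    have e: "{(i, j). i \<in> {x} \<and> j \<in> set xs \<and> j < i} = {}" using Cons.prems by auto
    moreover have "{x} \<inter> set xs = {}" using Cons.prems by auto
    ultimately have "ext_sign {x} (set xs) = (1 :: 'r)" unfolding ext_sign_def e by simp
    then have "ext_coeff (ext_gen x * ext_basis (set xs) :: ('n, 'r) ext) =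
        ext_coeff (ext_basis (set (x # xs)))"
      by (simp add: fun_eq_iff ext_coeff_basis_mult_basis ext_coeff_basis)
    with Cons show ?case by (simp add: ext_coeff_inject)
  qed
  from this[OF strict_sorted_list_of_set] show ?thesis by simp
qed


section \<open>The enveloping algebra \<open>A\<^sup>e = A \<otimes> A\<^sup>o\<^sup>p\<close>\<close>

text \<open>\<open>A\<^sup>e\<close> is free over \<open>R\<close> on the tensors \<open>x\<^sub>\<sigma> \<otimes> x\<^sub>\<sigma>\<^sub>'\<close>; in the second factor the order of
  multiplication is reversed.\<close>

definition env_op :: "'n set \<times> 'n set \<Rightarrow> 'n set \<times> 'n set \<Rightarrow> 'n set \<times> 'n set"
  where "env_op p q = (fst p \<union> fst q, snd q \<union> snd p)"

definition env_sign :: "'n::linorder set \<times> 'n set \<Rightarrow> 'n set \<times> 'n set \<Rightarrow> 'r::comm_ring_1"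
  where "env_sign p q = ext_sign (fst p) (fst q) * ext_sign (snd q) (snd p)"

lemma env_sign_cocycle:
  fixes p :: "'n::{finite,linorder} set \<times> 'n set"
  shows "env_sign p q * env_sign (env_op p q) r =
    (env_sign p (env_op q r) * env_sign q r :: 'r::comm_ring_1)"
proof -
  have "env_sign p q * env_sign (env_op p q) r =
      (ext_sign (fst p) (fst q) * ext_sign (fst p \<union> fst q) (fst r)) *
      (ext_sign (snd r) (snd q \<union> snd p) * ext_sign (snd q) (snd p) :: 'r)"
    by (simp add: env_sign_def env_op_def ac_simps)
  also have "\<dots> = (ext_sign (fst p) (fst q \<union> fst r) * ext_sign (fst q) (fst r)) *
      (ext_sign (snd r) (snd q) * ext_sign (snd r \<union> snd q) (snd p))"
    by (simp only: ext_sign_cocycle)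
  also have "\<dots> = env_sign p (env_op q r) * env_sign q r"
    by (simp add: env_sign_def env_op_def ac_simps)
  finally show ?thesis .
qed

typedef (overloaded) ('n, 'r) env =
  "UNIV :: ('n::{finite,linorder} set \<times> 'n set \<Rightarrow> 'r::comm_ring_1) set"
  morphisms env_coeff Abs_env ..

setup_lifting type_definition_env

instantiation env :: ("{finite,linorder}", comm_ring_1) ring_1
begin

lift_definition zero_env :: "('a, 'b) env" is "\<lambda>_. 0" .
lift_definition one_env :: "('a, 'b) env" is "\<lambda>p. if p = ({}, {}) then 1 else 0" .
lift_definition plus_env :: "('a, 'b) env \<Rightarrow> ('a, 'b) env \<Rightarrow> ('a, 'b) env" is "\<lambda>a b p. a p + b p" .
lift_definition minus_env :: "('a, 'b) env \<Rightarrow> ('a, 'b) env \<Rightarrow> ('a, 'b) env" is "\<lambda>a b p. a p - b p" .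
lift_definition uminus_env :: "('a, 'b) env \<Rightarrow> ('a, 'b) env" is "\<lambda>a p. - a p" .
lift_definition times_env :: "('a, 'b) env \<Rightarrow> ('a, 'b) env \<Rightarrow> ('a, 'b) env"
  is "twisted_mult env_op env_sign" .

instance
proof
  fix a b c :: "('a, 'b) env"
  show "a + b + c = a + (b + c)" by transfer (simp add: add.assoc)
  show "a + b = b + a" by transfer (simp add: add.commute)
  show "0 + a = a" by transfer simp
  show "- a + a = 0" by transfer simp
  show "a - b = a + - b" by transfer simp
  show "a * b * c = a * (b * c)"
    by transfer (rule twisted_mult_assoc, simp add: env_op_def Un_assoc, rule env_sign_cocycle)
  show "1 * a = a"
    by transfer (rule twisted_mult_unit_left, simp_all add: env_op_def env_sign_def)
  show "a * 1 = a"
    by transfer (rule twisted_mult_unit_right, simp_all add: env_op_def env_sign_def)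
  show "(a + b) * c = a * c + b * c" by transfer (rule twisted_mult_distrib)
  show "a * (b + c) = a * b + a * c" by transfer (rule twisted_mult_distrib)
  show "(0 :: ('a, 'b) env) \<noteq> 1" by transfer (auto simp: fun_eq_iff)
qed

end

lift_definition env_tensor ::
  "('n::{finite,linorder}, 'r::comm_ring_1) ext \<Rightarrow> ('n, 'r) ext \<Rightarrow> ('n, 'r) env"
  is "\<lambda>a b (\<sigma>, \<tau>). a \<sigma> * b \<tau>" .

lift_definition env_scalar :: "'r::comm_ring_1 \<Rightarrow> ('n::{finite,linorder}, 'r) env"
  is "\<lambda>c p. if p = ({}, {}) then c else 0" .

lemma env_tensor_one: "env_tensor 1 1 = 1"
  by transfer (auto simp: fun_eq_iff)

lemma env_tensor_mult: "env_tensor a b * env_tensor c d = env_tensor (a * c) (d * b)"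
proof (transfer, rule ext)
  fix a b c d :: "'a set \<Rightarrow> 'b" and z :: "'a set \<times> 'a set"
  obtain \<rho> \<pi> where z: "z = (\<rho>, \<pi>)" by force
  have "twisted_mult env_op env_sign (\<lambda>(\<sigma>, \<tau>). a \<sigma> * b \<tau>) (\<lambda>(\<sigma>, \<tau>). c \<sigma> * d \<tau>) z =
     (\<Sum>\<sigma>\<in>UNIV. \<Sum>\<tau>\<in>UNIV. \<Sum>\<sigma>'\<in>UNIV. \<Sum>\<tau>'\<in>UNIV.
        (if \<sigma> \<union> \<sigma>' = \<rho> then ext_sign \<sigma> \<sigma>' * a \<sigma> * c \<sigma>' else 0) *
        (if \<tau>' \<union> \<tau> = \<pi> then ext_sign \<tau>' \<tau> * d \<tau>' * b \<tau> else 0))"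
    unfolding twisted_mult_def z UNIV_Times_UNIV[symmetric] sum.cartesian_product'
    by (intro sum.cong refl) (auto simp: env_op_def env_sign_def)
  also have "\<dots> = (\<Sum>\<sigma>\<in>UNIV. \<Sum>\<sigma>'\<in>UNIV. \<Sum>\<tau>\<in>UNIV. \<Sum>\<tau>'\<in>UNIV.
        (if \<sigma> \<union> \<sigma>' = \<rho> then ext_sign \<sigma> \<sigma>' * a \<sigma> * c \<sigma>' else 0) *
        (if \<tau>' \<union> \<tau> = \<pi> then ext_sign \<tau>' \<tau> * d \<tau>' * b \<tau> else 0))"
    by (rule sum.cong[OF refl], rule sum.swap)
  also have "\<dots> = (\<Sum>\<sigma>\<in>UNIV. \<Sum>\<sigma>'\<in>UNIV. \<Sum>\<tau>'\<in>UNIV. \<Sum>\<tau>\<in>UNIV.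
        (if \<sigma> \<union> \<sigma>' = \<rho> then ext_sign \<sigma> \<sigma>' * a \<sigma> * c \<sigma>' else 0) *
        (if \<tau>' \<union> \<tau> = \<pi> then ext_sign \<tau>' \<tau> * d \<tau>' * b \<tau> else 0))"
    by (rule sum.cong[OF refl], rule sum.cong[OF refl], rule sum.swap)
  also have "\<dots> = twisted_mult (\<union>) ext_sign a c \<rho> * twisted_mult (\<union>) ext_sign d b \<pi>"
    unfolding twisted_mult_def
    by (simp only: sum_distrib_right) (simp only: sum_distrib_left)
  finally show "twisted_mult env_op env_sign (\<lambda>(\<sigma>, \<tau>). a \<sigma> * b \<tau>) (\<lambda>(\<sigma>, \<tau>). c \<sigma> * d \<tau>) z =
     (case z of (\<sigma>, \<tau>) \<Rightarrow> twisted_mult (\<union>) ext_sign a c \<sigma> * twisted_mult (\<union>) ext_sign d b \<tau>)"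
    by (simp add: z)
qed


section \<open>Free \<open>A\<^sup>e\<close>-modules\<close>

text \<open>The free left module over \<open>'e\<close> on the set of basis elements \<open>'x\<close> is \<open>'x \<Rightarrow>\<^sub>0 'e\<close>; the basis
  element \<open>x\<close> is \<open>Poly_Mapping.single x 1\<close>.\<close>

definition smult :: "'e::ring_1 \<Rightarrow> ('x \<Rightarrow>\<^sub>0 'e) \<Rightarrow> ('x \<Rightarrow>\<^sub>0 'e)"
  where "smult c f = Poly_Mapping.map ((*) c) f"

definition lin_ext :: "('x \<Rightarrow> ('y \<Rightarrow>\<^sub>0 'e::ring_1)) \<Rightarrow> ('x \<Rightarrow>\<^sub>0 'e) \<Rightarrow> ('y \<Rightarrow>\<^sub>0 'e)"
  where "lin_ext g f = (\<Sum>x\<in>Poly_Mapping.keys f. smult (Poly_Mapping.lookup f x) (g x))"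

lemma lookup_smult: "Poly_Mapping.lookup (smult c f) x = c * Poly_Mapping.lookup f x"
  unfolding smult_def by (simp add: Poly_Mapping.map.rep_eq when_def)

lemma smult_simps [simp]:
  "smult 0 f = 0" "smult 1 f = f" "smult c 0 = 0"
  by (rule poly_mapping_eqI; simp add: lookup_smult)+

lemma smult_add: "smult (c + d) f = smult c f + smult d f"
  by (rule poly_mapping_eqI) (simp add: lookup_smult lookup_add distrib_right)

lemma smult_add_right: "smult c (f + g) = smult c f + smult c g"
  by (rule poly_mapping_eqI) (simp add: lookup_smult lookup_add distrib_left)

lemma smult_smult: "smult c (smult d f) = smult (c * d) f"
  by (rule poly_mapping_eqI) (simp add: lookup_smult mult.assoc)

lemma smult_sum: "smult c (sum f X) = (\<Sum>x\<in>X. smult c (f x))"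
  by (induction X rule: infinite_finite_induct) (simp_all add: smult_add_right)

lemma lin_ext_superset:
  assumes "finite X" "Poly_Mapping.keys f \<subseteq> X"
  shows "lin_ext g f = (\<Sum>x\<in>X. smult (Poly_Mapping.lookup f x) (g x))"
  unfolding lin_ext_def using assms
  by (intro sum.mono_neutral_left) (auto simp: in_keys_iff)

lemma lin_ext_single [simp]: "lin_ext g (Poly_Mapping.single x c) = smult c (g x)"
  by (simp add: lin_ext_superset[where X = "{x}"])

lemma lin_ext_add: "lin_ext g (f + f') = lin_ext g f + lin_ext g f'"
proof -
  let ?X = "Poly_Mapping.keys f \<union> Poly_Mapping.keys f'"
  have "Poly_Mapping.keys (f + f') \<subseteq> ?X" by (rule keys_add)
  then show ?thesis
    by (simp add: lin_ext_superset[where X = ?X] lookup_add smult_add sum.distrib)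
qed

lemma lin_ext_smult: "lin_ext g (smult c f) = smult c (lin_ext g f)"
proof -
  have "Poly_Mapping.keys (smult c f) \<subseteq> Poly_Mapping.keys f"
    by (auto simp: in_keys_iff lookup_smult)
  then show ?thesis
    by (simp add: lin_ext_superset[where X = "Poly_Mapping.keys f"] lookup_smult smult_sum smult_smult)
qed


section \<open>The normalized bar resolution\<close>

text \<open>The word \<open>[\<sigma>\<^sub>1, ..., \<sigma>\<^sub>k]\<close> stands for the \<open>A\<^sup>e\<close>-basis element
  \<open>1 \<otimes> x\<^bsub>\<sigma>\<^sub>1\<^esub> \<otimes> ... \<otimes> x\<^bsub>\<sigma>\<^sub>k\<^esub> \<otimes> 1\<close> of \<open>B\<^sub>k\<close>. The elements of \<open>B\<^sub>*\<close> are the elements of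
  \<open>'n set list \<Rightarrow>\<^sub>0 ('n, 'r) env\<close> that are supported on \<open>bar_words\<close>.\<close>

definition bar_basis :: "nat \<Rightarrow> 'n set list set"
  where "bar_basis k = {v. length v = k \<and> {} \<notin> set v}"

definition bar_words :: "'n set list set"
  where "bar_words = (\<Union>k. bar_basis k)"

text \<open>The list \<open>[a\<^sub>0, ..., a\<^bsub>k+1\<^esub>]\<close> is sent to the class of \<open>a\<^sub>0 \<otimes> ... \<otimes> a\<^bsub>k+1\<^esub>\<close>: the inner factors are
  expanded in the basis \<open>x\<^sub>\<sigma>\<close>, where \<open>x\<^bsub>\<emptyset>\<^esub> = 1\<close> is zero by normalization.\<close>

definition bar_tensor ::
  "('n::{finite,linorder}, 'r::comm_ring_1) ext list \<Rightarrow> ('n set list \<Rightarrow>\<^sub>0 ('n, 'r) env)"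
  where "bar_tensor as = (\<Sum>v\<in>bar_basis (length as - 2).
    Poly_Mapping.single v
      (env_tensor (hd as) (last as) *
       env_scalar (\<Prod>j<length v. ext_coeff (as ! Suc j) (v ! j))))"

definition merge_at :: "nat \<Rightarrow> 'a::times list \<Rightarrow> 'a list"
  where "merge_at i as = take i as @ [as ! i * as ! Suc i] @ drop (i + 2) as"

definition word_tensor ::
  "'n::{finite,linorder} set list \<Rightarrow> ('n, 'r::comm_ring_1) ext list"
  where "word_tensor v = [1] @ map ext_basis v @ [1]"

text \<open>The empty word is special since the complex ends in degree 0.\<close>

definition bar_boundary_word ::
  "'n::{finite,linorder} set list \<Rightarrow> ('n set list \<Rightarrow>\<^sub>0 ('n, 'r::comm_ring_1) env)"
  where "bar_boundary_word v =
    (if v = [] then 0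
     else \<Sum>i\<le>length v. smult ((- 1) ^ i) (bar_tensor (merge_at i (word_tensor v))))"

definition bar_boundary ::
  "('n::{finite,linorder} set list \<Rightarrow>\<^sub>0 ('n, 'r::comm_ring_1) env) \<Rightarrow> ('n set list \<Rightarrow>\<^sub>0 ('n, 'r) env)"
  where "bar_boundary = lin_ext bar_boundary_word"

lemma finite_bar_basis: "finite (bar_basis k :: 'n::finite set list set)"
  by (rule finite_subset[OF _ finite_lists_length_eq[of "UNIV :: 'n set set" k]])
     (auto simp: bar_basis_def)

lemma bar_tensor_word_tensor:
  assumes "{} \<notin> set v"
  shows "bar_tensor (word_tensor v) =
    (Poly_Mapping.single v 1 :: 'n::{finite,linorder} set list \<Rightarrow>\<^sub>0 ('n, 'r::comm_ring_1) env)"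
proof -
  let ?as = "word_tensor v :: ('n, 'r) ext list"
  have len: "length ?as - 2 = length v" by (simp add: word_tensor_def)
  have nth: "?as ! Suc j = ext_basis (v ! j)" if "j < length v" for j
    using that by (simp add: word_tensor_def nth_append)
  have ends: "env_tensor (hd ?as) (last ?as) = 1" by (simp add: word_tensor_def env_tensor_one)
  have *: "(\<Prod>j<length v. ext_coeff (?as ! Suc j) (w ! j)) = (if w = v then 1 else 0)"
    if "length w = length v" for w
  proof (cases "w = v")
    case True
    then show ?thesis by (simp add: nth ext_coeff_basis)
  next
    case False
    with that obtain j where "j < length v" "w ! j \<noteq> v ! j" by (auto simp: list_eq_iff_nth_eq)
    then have "\<exists>j\<in>{..<length v}. ext_coeff (?as ! Suc j) (w ! j) = 0"
      using that by (intro bexI[of _ j]) (auto simp: nth ext_coeff_basis)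
    with False show ?thesis by (simp add: prod_zero)
  qed
  have sc: "(env_scalar 1 :: ('n, 'r) env) = 1" "(env_scalar 0 :: ('n, 'r) env) = 0"
    by (transfer; auto simp: fun_eq_iff)+
  have "bar_tensor ?as =
    (\<Sum>w\<in>bar_basis (length v). if w = v then Poly_Mapping.single v 1 else 0)"
    unfolding bar_tensor_def len ends
    by (intro sum.cong refl) (simp add: bar_basis_def * sc)
  then show ?thesis using assms finite_bar_basis[of "length v", where 'n = 'n]
    by (simp add: bar_basis_def)
qed

lemma smult_env_tensor_bar_tensor:
  assumes "as \<noteq> []"
  shows "smult (env_tensor \<alpha> \<beta>) (bar_tensor ([a] @ as @ [b])) =
    bar_tensor ([\<alpha> * a] @ as @ [b * \<beta>])"
proof -
  have nth: "([x] @ as @ [y]) ! Suc j = as ! j" if "j < length as" for x y j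
    using that by (simp add: nth_append)
  show ?thesis
    unfolding bar_tensor_def smult_sum
  proof (intro sum.cong)
    fix v :: "'a set list" assume "v \<in> bar_basis (length ([\<alpha> * a] @ as @ [b * \<beta>]) - 2)"
    then have l: "length v = length as" by (simp add: bar_basis_def)
    have "(\<Prod>j<length v. ext_coeff (([a] @ as @ [b]) ! Suc j) (v ! j)) =
        (\<Prod>j<length v. ext_coeff (([\<alpha> * a] @ as @ [b * \<beta>]) ! Suc j) (v ! j))"
      by (intro prod.cong refl) (simp add: nth l del: append.simps)
    moreover have "smult c (Poly_Mapping.single v d) = Poly_Mapping.single v (c * d)"
      for c d :: "('a, 'b) env"
      by (rule poly_mapping_eqI) (simp add: lookup_smult lookup_single when_def)
    ultimately show "smult (env_tensor \<alpha> \<beta>) (Poly_Mapping.single v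
        (env_tensor (hd ([a] @ as @ [b])) (last ([a] @ as @ [b])) *
          env_scalar (\<Prod>j<length v. ext_coeff (([a] @ as @ [b]) ! Suc j) (v ! j)))) =
      Poly_Mapping.single v
        (env_tensor (hd ([\<alpha> * a] @ as @ [b * \<beta>])) (last ([\<alpha> * a] @ as @ [b * \<beta>])) *
          env_scalar (\<Prod>j<length v. ext_coeff (([\<alpha> * a] @ as @ [b * \<beta>]) ! Suc j) (v ! j)))"
      by (simp add: env_tensor_mult mult.assoc[symmetric])
  qed simp
qed


section \<open>Weighted digraphs\<close>

text \<open>An edge is a triple (source, weight, target).\<close>

type_synonym ('v, 'e) wdigraph = "('v \<times> 'e \<times> 'v) set"

fun dpath :: "('v, 'e) wdigraph \<Rightarrow> 'v \<Rightarrow> ('v \<times> 'e \<times> 'v) list \<Rightarrow> 'v \<Rightarrow> bool"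
  where
    "dpath G u [] v \<longleftrightarrow> u = v"
  | "dpath G u (e # es) v \<longleftrightarrow> e \<in> G \<and> fst e = u \<and> dpath G (snd (snd e)) es v"

definition path_weight :: "('v \<times> 'e::monoid_mult \<times> 'v) list \<Rightarrow> 'e"
  where "path_weight es = prod_list (map (\<lambda>(_, w, _). w) es)"

text \<open>The sum below is meant for pairs joined by finitely many paths only. This is the case in
  \<open>morse_digraph\<close>, which is acyclic and in which every vertex reaches only finitely many others.\<close>

definition path_sum :: "('v, 'e::ring_1) wdigraph \<Rightarrow> 'v \<Rightarrow> 'v \<Rightarrow> 'e"
  where "path_sum G u v = (\<Sum>es | dpath G u es v. path_weight es)"

definition unit_inverse :: "'e::ring_1 \<Rightarrow> 'e"
  where "unit_inverse w = (THE u. w * u = 1 \<and> u * w = 1)"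

definition reverse_along :: "('v, 'e::ring_1) wdigraph \<Rightarrow> ('v \<times> 'v) set \<Rightarrow> ('v, 'e) wdigraph"
  where "reverse_along G M =
    {(u, w, v). (u, w, v) \<in> G \<and> (u, v) \<notin> M} \<union>
    {(v, - unit_inverse w, u) | u w v. (u, w, v) \<in> G \<and> (u, v) \<in> M}"


section \<open>The Morse matching and the maps it induces\<close>

definition bar_digraph ::
  "('n::{finite,linorder} set list, ('n, 'r::comm_ring_1) env) wdigraph"
  where "bar_digraph = {(v, w, v'). v \<in> bar_words \<and> v' \<in> bar_words \<and>
    w = Poly_Mapping.lookup (bar_boundary (Poly_Mapping.single v 1)) v' \<and> w \<noteq> 0}"

abbreviation singletons :: "'n list \<Rightarrow> 'n set list"
  where "singletons is \<equiv> map (\<lambda>i. {i}) is"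

definition matching :: "('n::{finite,linorder} set list \<times> 'n set list) set"
  where "matching =
    {(singletons is @ [{i}, \<sigma> - {i}] @ \<rho>, singletons is @ [\<sigma>] @ \<rho>) | is i \<sigma> \<rho>.
       {} \<notin> set \<rho> \<and> card \<sigma> \<ge> 2 \<and> i = Max \<sigma> \<and> sorted (is @ [i])}"

definition morse_digraph ::
  "('n::{finite,linorder} set list, ('n, 'r::comm_ring_1) env) wdigraph"
  where "morse_digraph = reverse_along bar_digraph matching"

text \<open>The Morse complex is \<open>'n multiset \<Rightarrow>\<^sub>0 ('n, 'r) env\<close>, where the multiset \<open>\<tau>\<close> stands for
  the basis element \<open>x\<^bsub>(\<tau>)\<^esub>\<close>, of degree \<open>size \<tau>\<close>.\<close>

definition critical_word :: "'n::linorder multiset \<Rightarrow> 'n set list"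
  where "critical_word \<tau> = singletons (sorted_list_of_multiset \<tau>)"

lemma finite_multisets_of_size: "finite {\<tau> :: 'n::finite multiset. size \<tau> = k}"
proof -
  have "{\<tau> :: 'n multiset. size \<tau> = k} \<subseteq> mset ` {xs. set xs \<subseteq> UNIV \<and> length xs = k}"
  proof
    fix \<tau> :: "'n multiset" assume "\<tau> \<in> {\<tau>. size \<tau> = k}"
    moreover obtain xs where "mset xs = \<tau>" using ex_mset by blast
    ultimately show "\<tau> \<in> mset ` {xs. set xs \<subseteq> UNIV \<and> length xs = k}" by auto
  qed
  then show ?thesis by (rule finite_subset) (simp only: finite_imageI finite_lists_length_eq finite)
qed

definition morse_boundary ::
  "('n::{finite,linorder} multiset \<Rightarrow>\<^sub>0 ('n, 'r::comm_ring_1) env) \<Rightarrow> ('n multiset \<Rightarrow>\<^sub>0 ('n, 'r) env)"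
  where "morse_boundary = lin_ext (\<lambda>\<tau>. \<Sum>\<tau>' | size \<tau> = Suc (size \<tau>').
    Poly_Mapping.single \<tau>' (path_sum morse_digraph (critical_word \<tau>) (critical_word \<tau>')))"

definition morse_h ::
  "('n::{finite,linorder} multiset \<Rightarrow>\<^sub>0 ('n, 'r::comm_ring_1) env) \<Rightarrow> ('n set list \<Rightarrow>\<^sub>0 ('n, 'r) env)"
  where "morse_h = lin_ext (\<lambda>\<tau>. \<Sum>v\<in>bar_basis (size \<tau>).
    Poly_Mapping.single v (path_sum morse_digraph (critical_word \<tau>) v))"

definition morse_h_inv ::
  "('n::{finite,linorder} set list \<Rightarrow>\<^sub>0 ('n, 'r::comm_ring_1) env) \<Rightarrow> ('n multiset \<Rightarrow>\<^sub>0 ('n, 'r) env)"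
  where "morse_h_inv = lin_ext (\<lambda>v. \<Sum>\<tau> | size \<tau> = length v.
    Poly_Mapping.single \<tau> (path_sum morse_digraph v (critical_word \<tau>)))"

end

theory Submission
  imports Defs
begin

text \<open>
  A word of singletons \<open>x\<^sub>j\<^sub>1 \<otimes> ... \<otimes> x\<^sub>j\<^sub>k\<close> has no reversed matching edge leaving it, and a reversed
  edge is never followed by another one. A path that returns to the degree it started in
  therefore alternates between a boundary edge and a reversed edge, and every such pair swaps
  two neighbours \<open>a < b\<close> into \<open>b, a\<close>, where the part up to and including the new \<open>b\<close> is sorted;
  its weight is 1. The pair \<open>b, a\<close> is then the first descent of the new word, so that every word
  has at most one predecessor: undoing first descents is a sorting procedure, and there is
  exactly one path from the sorted word to each rearrangement. Conversely, no nonempty path leads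
  from a word of singletons to a critical word of the same degree.
\<close>

section \<open>The boundary of a word of singletons\<close>

lemma env_scalar_simps [simp]:
  "(env_scalar 0 :: ('n::{finite,linorder}, 'r::comm_ring_1) env) = 0"
  "(env_scalar 1 :: ('n, 'r) env) = 1"
  "(env_scalar (- c) :: ('n, 'r) env) = - env_scalar c"
  by (transfer; auto simp: fun_eq_iff)+

text \<open>The outer factors act as scalars of \<open>env\<close>; only the inner ones are
  expanded. Turning the indexed product of \<open>bar_tensor\<close> into one over a zipped list
  makes it possible to cut it at a merged position.\<close>

lemma lookup_bar_tensor:
  "Poly_Mapping.lookup (bar_tensor ([a] @ as @ [b])) v =
    (if v \<in> bar_basis (length as)
     then env_tensor a b * env_scalar (prod_list (map2 ext_coeff as v)) else 0)"
proof -
  let ?c = "\<lambda>w. env_tensor a b *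
    env_scalar (\<Prod>j<length w. ext_coeff (([a] @ as @ [b]) ! Suc j) (w ! j))"
  have "Poly_Mapping.lookup (bar_tensor ([a] @ as @ [b])) v =
      (\<Sum>w\<in>bar_basis (length as). Poly_Mapping.lookup (Poly_Mapping.single w (?c w)) v)"
    unfolding bar_tensor_def by (simp add: lookup_sum)
  also have "\<dots> = (\<Sum>w\<in>bar_basis (length as). if w = v then ?c v else 0)"
    by (intro sum.cong refl) (auto simp: lookup_single)
  also have "\<dots> = (if v \<in> bar_basis (length as) then ?c v else 0)"
    by (simp add: finite_bar_basis)
  also have "(\<Prod>j<length v. ext_coeff (([a] @ as @ [b]) ! Suc j) (v ! j)) =
      prod_list (map2 ext_coeff as v)" if "length v = length as"
    unfolding prod.list_conv_set_nth using that
    by (simp add: atLeast0LessThan nth_append)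
  ultimately show ?thesis by (auto simp: bar_basis_def)
qed

lemma prod_list_ext_coeff_basis:
  assumes "length w = length v"
  shows "prod_list (map2 ext_coeff (map ext_basis w) v) =
    (if v = w then 1 else 0 :: 'r::comm_ring_1)"
  using assms by (induction w v rule: list_induct2) (auto simp: ext_coeff_basis)

lemma lookup_bar_tensor_basis:
  assumes "{} \<notin> set w"
  shows "Poly_Mapping.lookup (bar_tensor ([a] @ map ext_basis w @ [b])) v =
    (if v = w then env_tensor a b else 0)"
  using assms unfolding lookup_bar_tensor by (auto simp: bar_basis_def prod_list_ext_coeff_basis)

text \<open>A product of two basis elements of the exterior algebra is a multiple of a single basis
  element, so a merge yields at most one word. If \<sigma> and \<tau> meet, the multiple is
  0.\<close>

lemma lookup_bar_tensor_merged:
  fixes v :: "'n::{finite,linorder} set list"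
  assumes "{} \<notin> set u" "{} \<notin> set w" "\<sigma> \<noteq> {}"
  shows "Poly_Mapping.lookup (bar_tensor
      ([1] @ (map ext_basis u @ [ext_basis \<sigma> * ext_basis \<tau>] @ map ext_basis w) @ [1])) v =
    (if v = u @ [\<sigma> \<union> \<tau>] @ w
     then env_scalar (ext_sign \<sigma> \<tau>) :: ('n, 'r::comm_ring_1) env else 0)"
proof (cases "length v = length (u @ [\<sigma> \<union> \<tau>] @ w)")
  case True
  obtain v1 s v2 where v: "v = v1 @ [s] @ v2" "length u = length v1" "length w = length v2"
  proof
    show "v = take (length u) v @ [v ! length u] @ drop (Suc (length u)) v"
      unfolding append_Cons append_Nil by (rule id_take_nth_drop) (use True in simp)
  qed (use True in auto)
  have "prod_list (map2 ext_coeff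
      (map ext_basis u @ [ext_basis \<sigma> * ext_basis \<tau>] @ map ext_basis w) v) =
    (if v1 = u then 1 else 0) * ((if s = \<sigma> \<union> \<tau> then ext_sign \<sigma> \<tau> else 0) *
      (if v2 = w then 1 else 0 :: 'r))"
    unfolding v(1) ext_coeff_basis_mult_basis[symmetric]
      prod_list_ext_coeff_basis[OF v(2), symmetric] prod_list_ext_coeff_basis[OF v(3), symmetric]
    using v(2,3) by (simp only: zip_append length_map map_append prod_list.append) simp
  moreover have "v \<in> bar_basis (length (map ext_basis u @ [ext_basis \<sigma> * ext_basis \<tau>] @
      map ext_basis w :: ('n, 'r) ext list))" if "v = u @ [\<sigma> \<union> \<tau>] @ w"
    using assms by (simp add: that bar_basis_def)
  moreover have "v = u @ [\<sigma> \<union> \<tau>] @ w \<longleftrightarrow> v1 = u \<and> s = \<sigma> \<union> \<tau> \<and> v2 = w"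
    unfolding v(1) using v(2) by simp
  ultimately show ?thesis
    unfolding lookup_bar_tensor env_tensor_one mult_1_left
    by (cases "v = u @ [\<sigma> \<union> \<tau>] @ w") (simp_all only: if_True if_False simp_thms mult_1_left
      mult_1_right mult_zero_left mult_zero_right env_scalar_simps if_cancel split: if_splits)
next
  case False
  then show ?thesis unfolding lookup_bar_tensor by (auto simp: bar_basis_def)
qed

lemma lookup_bar_boundary:
  "Poly_Mapping.lookup (bar_boundary (Poly_Mapping.single v 1)) v' =
    (if v = [] then 0 else \<Sum>i\<le>length v. (- 1) ^ i *
      Poly_Mapping.lookup (bar_tensor (merge_at i (word_tensor v))) v')"
  by (simp add: bar_boundary_def bar_boundary_word_def lookup_sum lookup_smult)

text \<open>Multiplying into an outer factor removes the first or last letter, which survives only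
  in the coefficient. What remains is again a word of singletons.\<close>

lemma lookup_merge_ends:
  fixes js :: "'n::{finite,linorder} list"
  assumes "js \<noteq> []"
  shows "Poly_Mapping.lookup (bar_tensor (merge_at 0 (word_tensor (singletons js)))) v =
      (if v = singletons (tl js)
       then env_tensor (ext_gen (hd js)) 1 :: ('n, 'r::comm_ring_1) env else 0)"
    and "Poly_Mapping.lookup (bar_tensor (merge_at (length js) (word_tensor (singletons js)))) v =
      (if v = singletons (butlast js)
       then env_tensor 1 (ext_gen (last js)) :: ('n, 'r) env else 0)"
proof -
  have l: "merge_at 0 (word_tensor (singletons js)) =
      [ext_gen (hd js)] @ map ext_basis (singletons (tl js)) @ [1 :: ('n, 'r) ext]"
    using assms by (cases js) (auto simp: merge_at_def word_tensor_def)
  show "Poly_Mapping.lookup (bar_tensor (merge_at 0 (word_tensor (singletons js)))) v =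
      (if v = singletons (tl js) then env_tensor (ext_gen (hd js)) 1 :: ('n, 'r) env else 0)"
    unfolding l by (rule lookup_bar_tensor_basis) auto
  have r: "merge_at (length js) (word_tensor (singletons js)) =
      [1] @ map ext_basis (singletons (butlast js)) @ [ext_gen (last js) :: ('n, 'r) ext]"
    using assms by (cases js rule: rev_cases) (auto simp: merge_at_def word_tensor_def nth_append)
  show "Poly_Mapping.lookup (bar_tensor (merge_at (length js) (word_tensor (singletons js)))) v =
      (if v = singletons (butlast js) then env_tensor 1 (ext_gen (last js)) :: ('n, 'r) env else 0)"
    unfolding r by (rule lookup_bar_tensor_basis) auto
qed

text \<open>The letter \<open>{a, b}\<close> forgets the order of \<open>a\<close> and
  \<open>b\<close>, so the words with \<open>a, b\<close> and with \<open>b, a\<close> share this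
  merged word; every swap passes through it.\<close>

abbreviation merged_word :: "'n list \<Rightarrow> 'n \<Rightarrow> 'n \<Rightarrow> 'n list \<Rightarrow> 'n set list"
  where "merged_word us a b vs \<equiv> singletons us @ [{a, b}] @ singletons vs"

lemma lookup_merge_inner:
  fixes us :: "'n::{finite,linorder} list"
  shows "Poly_Mapping.lookup (bar_tensor
      (merge_at (Suc (length us)) (word_tensor (singletons (us @ [a, b] @ vs))))) v =
    (if v = merged_word us a b vs
     then env_scalar (ext_sign {a} {b}) :: ('n, 'r::comm_ring_1) env else 0)"
proof -
  have e: "merge_at (Suc (length us)) (word_tensor (singletons (us @ [a, b] @ vs))) =
      [1] @ (map ext_basis (singletons us) @ [ext_gen a * ext_gen b] @ map ext_basis (singletons vs)) @
      [1 :: ('n, 'r) ext]"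
    by (simp add: merge_at_def word_tensor_def nth_append)
  have "{a} \<union> {b} = {a, b}" by auto
  then show ?thesis
    unfolding e by (subst lookup_bar_tensor_merged) auto
qed

text \<open>The first letter that is not a singleton cuts a word in only one way. This recovers from
  a merged word both the place of the merge and the only possible matching edge into it.\<close>

lemma first_nonsingleton_unique:
  assumes "singletons us @ \<sigma> # \<rho> = singletons us' @ \<sigma>' # \<rho>'"
    and "\<And>i. \<sigma> \<noteq> {i}" "\<And>i. \<sigma>' \<noteq> {i}"
  shows "us = us'" "\<sigma> = \<sigma>'" "\<rho> = \<rho>'"
proof -
  have "us = us' \<and> \<sigma> = \<sigma>' \<and> \<rho> = \<rho>'"
    using assms(1)
  proof (induction us arbitrary: us')
    case Nil
    then show ?case using assms(2,3) by (cases us') auto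
  next
    case (Cons u us)
    then show ?case using assms(2)[of u] assms(3)[of u] by (cases us') auto
  qed
  then show "us = us'" "\<sigma> = \<sigma>'" "\<rho> = \<rho>'" by auto
qed

lemma singletons_no_nonsingleton:
  assumes "\<And>i. \<sigma> \<noteq> {i}"
  shows "singletons us \<noteq> singletons us' @ \<sigma> # \<rho>"
  using assms by (metis (mono_tags, lifting) image_iff in_set_conv_decomp set_map)

text \<open>\<open>word_tensor\<close> puts a factor 1 in front, so a merge at \<open>i\<close>
  joins the letters of \<open>js\<close> at \<open>i - 1\<close> and \<open>i\<close>.\<close>

lemma inner_position_cases:
  assumes "0 < i" "i < length js"
  obtains us a b vs where "js = us @ [a, b] @ vs" "i = Suc (length us)"
proof
  show "js = take (i - 1) js @ [js ! (i - 1), js ! i] @ drop (Suc i) js"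
    using assms by (metis Cons_nth_drop_Suc Suc_diff_1 append_Cons append_Nil append_take_drop_id
      less_imp_diff_less)
  show "i = Suc (length (take (i - 1) js))" using assms by simp
qed

text \<open>Merges at the two ends fall under the first case, inner ones under the second; equal
  neighbours drop out because a generator squares to zero.\<close>

lemma boundary_singletons_cases:
  fixes js :: "'n::{finite,linorder} list"
  assumes "Poly_Mapping.lookup (bar_boundary
    (Poly_Mapping.single (singletons js) (1 :: ('n, 'r::comm_ring_1) env))) v \<noteq> 0"
  obtains ks where "v = singletons ks"
    | us a b vs where "js = us @ [a, b] @ vs" "a \<noteq> b" "v = merged_word us a b vs"
proof -
  let ?l = "\<lambda>i. Poly_Mapping.lookup (bar_tensor (merge_at i (word_tensor (singletons js)))) v
    :: ('n, 'r) env"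
  from assms have js: "js \<noteq> []" and "(\<Sum>i\<le>length js. (- 1) ^ i * ?l i) \<noteq> 0"
    unfolding lookup_bar_boundary by (auto split: if_splits)
  then obtain i where i: "i \<le> length js" "?l i \<noteq> 0"
    by (metis (no_types, lifting) atMost_iff mult_zero_right sum.not_neutral_contains_not_neutral)
  then consider "i = 0" | "i = length js" | "0 < i" "i < length js" by linarith
  then show ?thesis
  proof cases
    case 3
    then obtain us a b vs where *: "js = us @ [a, b] @ vs" "i = Suc (length us)"
      by (rule inner_position_cases)
    with i(2) have "v = merged_word us a b vs" "a \<noteq> b"
      unfolding * lookup_merge_inner by (auto simp: ext_sign_singletons split: if_splits)
    with * that(2) show ?thesis by blast
  qed (use i that(1) lookup_merge_ends[OF js, of v] in \<open>auto split: if_splits\<close>)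
qed

lemma boundary_merged_word:
  fixes us :: "'n::{finite,linorder} list"
  assumes "a \<noteq> b"
  shows "Poly_Mapping.lookup (bar_boundary (Poly_Mapping.single (singletons (us @ [a, b] @ vs)) 1))
      (merged_word us a b vs) =
    (- 1) ^ Suc (length us) * (if a < b then 1 else - 1 :: ('n, 'r::comm_ring_1) env)"
proof -
  let ?js = "us @ [a, b] @ vs"
  let ?l = "\<lambda>i. Poly_Mapping.lookup (bar_tensor (merge_at i (word_tensor (singletons ?js))))
    (merged_word us a b vs) :: ('n, 'r) env"
  have ns: "{a, b} \<noteq> {i}" for i using assms by auto
  \<comment> \<open>No other term can interfere: the end merges give words of singletons, and an
    inner merge elsewhere puts the first nonsingleton letter at a different position.\<close>
  have l0: "?l i = 0" if le: "i \<le> length ?js" and i: "i \<noteq> Suc (length us)" for i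
  proof -
    have no: "merged_word us a b vs \<noteq> singletons ks" for ks
      using singletons_no_nonsingleton[OF ns, of ks us "singletons vs"] by auto
    have ne: "?js \<noteq> []" by simp
    consider "i = 0" | "i = length ?js" | "0 < i" "i < length ?js"
      using le le_neq_implies_less by blast
    then show ?thesis
    proof cases
      case 1
      show ?thesis unfolding 1 lookup_merge_ends(1)[OF ne] by (simp only: no if_False)
    next
      case 2
      show ?thesis unfolding 2 lookup_merge_ends(2)[OF ne] by (simp only: no if_False)
    next
      case 3
      then obtain us' a' b' vs' where *: "?js = us' @ [a', b'] @ vs'" "i = Suc (length us')"
        by (rule inner_position_cases)
      show ?thesis
      proof (cases "a' = b'")
        case True
        then show ?thesis unfolding * lookup_merge_inner by (simp add: ext_sign_singletons)
      next
        case False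
        then have "{a', b'} \<noteq> {i}" for i by auto
        then have "merged_word us a b vs \<noteq> merged_word us' a' b' vs'"
          using first_nonsingleton_unique(1)[OF _ ns, of us "singletons vs" us' "{a', b'}"
            "singletons vs'"] * i by auto
        then show ?thesis unfolding * lookup_merge_inner by simp
      qed
    qed
  qed
  have "Poly_Mapping.lookup (bar_boundary (Poly_Mapping.single (singletons ?js) 1))
      (merged_word us a b vs) = (\<Sum>i\<le>length ?js. (- 1) ^ i * ?l i)"
    unfolding lookup_bar_boundary by simp
  also have "\<dots> = (\<Sum>i\<in>{Suc (length us)}. (- 1) ^ i * ?l i)"
    by (rule sum.mono_neutral_right) (use l0 in auto)
  also have "\<dots> = (- 1) ^ Suc (length us) * (if a < b then 1 else - 1)"
  proof -
    have "?l (Suc (length us)) = (if a < b then 1 else - 1)"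
      unfolding lookup_merge_inner using assms by (auto simp: ext_sign_singletons)
    then show ?thesis by (simp only: sum.insert finite.emptyI empty_iff sum.empty simp_thms add_0_right)
  qed
  finally show ?thesis .
qed

section \<open>Paths in the Morse digraph\<close>

text \<open>Every merge replaces two factors by one, and \<open>bar_tensor\<close> is supported on
  words of a single length. The length of a word is its degree.\<close>

lemma length_bar_digraph_edge:
  fixes w :: "('n::{finite,linorder}, 'r::comm_ring_1) env"
  assumes "(u, w, v) \<in> bar_digraph"
  shows "length u = Suc (length v)"
proof -
  from assms have "u \<noteq> []" and "(\<Sum>i\<le>length u. (- 1) ^ i *
      Poly_Mapping.lookup (bar_tensor (merge_at i (word_tensor u))) v) \<noteq> (0 :: ('n, 'r) env)"
    unfolding bar_digraph_def lookup_bar_boundary by (auto split: if_splits)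
  then obtain i where i: "i \<le> length u"
    and "Poly_Mapping.lookup (bar_tensor (merge_at i (word_tensor u))) v \<noteq> (0 :: ('n, 'r) env)"
    by (metis (no_types, lifting) atMost_iff mult_zero_right sum.not_neutral_contains_not_neutral)
  from this(2) have "v \<in> bar_basis (length (merge_at i (word_tensor u :: ('n, 'r) ext list)) - 2)"
    unfolding bar_tensor_def lookup_sum
    by (rule sum.not_neutral_contains_not_neutral) (auto simp: lookup_single when_def split: if_splits)
  with i \<open>u \<noteq> []\<close> show ?thesis
    by (cases u) (auto simp: bar_basis_def merge_at_def word_tensor_def)
qed

section \<open>The matching on words\<close>

lemma matchingE:
  assumes "(u, v) \<in> matching"
  obtains ps i \<sigma> \<rho> where "u = singletons (ps @ [i]) @ (\<sigma> - {i}) # \<rho>" "v = singletons ps @ \<sigma> # \<rho>"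
    "i = Max \<sigma>" "sorted (ps @ [i])" "i \<in> \<sigma>" "\<And>j. \<sigma> \<noteq> {j}" "\<And>j. j \<in> \<sigma> - {i} \<Longrightarrow> j < i"
proof -
  from assms obtain ps i \<sigma> \<rho> where *: "u = singletons ps @ [{i}, \<sigma> - {i}] @ \<rho>"
      "v = singletons ps @ [\<sigma>] @ \<rho>" "card \<sigma> \<ge> 2" "i = Max \<sigma>" "sorted (ps @ [i])"
    unfolding matching_def by auto
  then have "\<sigma> \<noteq> {}" by auto
  with *(4) have "i \<in> \<sigma>" "\<And>j. j \<in> \<sigma> - {i} \<Longrightarrow> j < i" by (auto simp: less_le)
  moreover have "\<sigma> \<noteq> {j}" for j using *(3) by auto
  ultimately show ?thesis using that[of ps i \<sigma> \<rho>] * by auto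
qed

text \<open>The shorter end of a matching edge has a letter with at least two elements. Hence no
  reversed edge leaves a word of singletons.\<close>

lemma singletons_notin_Range_matching: "singletons js \<notin> Range matching"
proof
  assume "singletons js \<in> Range matching"
  then obtain u where "(u, singletons js) \<in> matching" by auto
  then obtain ps \<sigma> \<rho> where "singletons js = singletons ps @ \<sigma> # \<rho>" "\<And>j. \<sigma> \<noteq> {j}"
    by (rule matchingE) blast
  then show False using singletons_no_nonsingleton by metis
qed

text \<open>In the longer end of a matching edge, \<open>i\<close> is followed by a letter whose
  elements lie below \<open>i\<close>. If that letter is a singleton, this is a descent, which a
  sorted word lacks. Hence no reversed edge ends in a critical word.\<close>

lemma critical_word_notin_Domain_matching: "critical_word \<tau> \<notin> Domain matching"
proof
  assume "critical_word \<tau> \<in> Domain matching"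
  then obtain v where "(critical_word \<tau>, v) \<in> matching" by auto
  then obtain ps i \<sigma> \<rho> where e: "critical_word \<tau> = singletons (ps @ [i]) @ (\<sigma> - {i}) # \<rho>"
    and lt: "\<And>j. j \<in> \<sigma> - {i} \<Longrightarrow> j < i" by (rule matchingE) blast
  let ?js = "sorted_list_of_multiset \<tau>"
  from e obtain ks ls where ks: "?js = ks @ ls" "singletons ks = singletons (ps @ [i])"
    "singletons ls = (\<sigma> - {i}) # \<rho>"
    unfolding critical_word_def map_eq_append_conv[of _ _ "singletons (ps @ [i])"] by metis
  from ks(2) have "ks = ps @ [i]" by (metis (mono_tags) inj_map_eq_map inj_singleton)
  moreover from ks(3) obtain m ms where "ls = m # ms" "{m} = \<sigma> - {i}" by auto
  moreover have "sorted ?js" by simp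
  moreover from \<open>{m} = \<sigma> - {i}\<close> have "m < i" using lt[of m] by blast
  ultimately show False using ks(1) by (auto simp: sorted_append)
qed

text \<open>As a longer end, \<open>v\<close> has \<open>i\<close> followed by a letter with
  elements below \<open>i\<close>; as a shorter end, \<open>v\<close> is sorted up to the maximum of
  its first nonsingleton letter. These exclude each other, whether or not the letter after
  \<open>i\<close> is a singleton. Hence two reversed edges never follow each other.\<close>

lemma Domain_matching_Int_Range: "Domain matching \<inter> Range matching = {}"
proof -
  have False if "(v, u) \<in> matching" "(w, v) \<in> matching" for u v w :: "'a set list"
  proof -
    from that(1) obtain ps i \<sigma> \<rho> where v: "v = singletons (ps @ [i]) @ (\<sigma> - {i}) # \<rho>"
      and lt: "\<And>j. j \<in> \<sigma> - {i} \<Longrightarrow> j < i" by (rule matchingE) blast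
    from that(2) obtain ps' i' \<sigma>' \<rho>' where v': "v = singletons ps' @ \<sigma>' # \<rho>'"
      and s: "i' = Max \<sigma>'" "sorted (ps' @ [i'])" "i' \<in> \<sigma>'" "\<And>j. \<sigma>' \<noteq> {j}" by (rule matchingE) blast
    show False
    proof (cases "\<exists>m. \<sigma> - {i} = {m}")
      case False
      then have "\<And>m. \<sigma> - {i} \<noteq> {m}" by auto
      from first_nonsingleton_unique[OF _ this s(4), of "ps @ [i]" \<rho> ps' \<rho>'] v v'
      have "ps' = ps @ [i]" "\<sigma>' = \<sigma> - {i}" by auto
      with s lt[of i'] show False by (auto simp: sorted_append)
    next
      case True
      then obtain m where m: "\<sigma> - {i} = {m}" by blast
      with v v' have eq: "singletons (ps @ [i, m]) @ \<rho> = singletons ps' @ \<sigma>' # \<rho>'" by simp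
      \<comment> \<open>The prefix \<open>ps'\<close> reaches up to the first nonsingleton letter,
        so it covers \<open>i\<close> and the smaller \<open>m\<close>, although it is
        sorted.\<close>
      have "\<exists>zs. ps' = (ps @ [i, m]) @ zs"
      proof -
        from eq consider zs where "singletons (ps @ [i, m]) = singletons ps' @ zs" "zs @ \<rho> = \<sigma>' # \<rho>'"
          | zs where "singletons (ps @ [i, m]) @ zs = singletons ps'" "\<rho> = zs @ \<sigma>' # \<rho>'"
          unfolding append_eq_append_conv2 by blast
        then show ?thesis
        proof cases
          case 1
          show ?thesis
          proof (cases zs)
            case Nil
            with 1(1) have "ps @ [i, m] = ps'" by (metis append_Nil2 inj_map_eq_map inj_singleton)
            then show ?thesis by simp
          next
            case (Cons z zs')
            with 1 have "singletons (ps @ [i, m]) = singletons ps' @ \<sigma>' # zs'" by simp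
            with singletons_no_nonsingleton[OF s(4)] show ?thesis by metis
          qed
        next
          case 2
          then obtain xs ys where "ps' = xs @ ys" "singletons xs = singletons (ps @ [i, m])"
            by (metis map_eq_append_conv)
          then show ?thesis by (metis inj_map_eq_map inj_singleton)
        qed
      qed
      with s(2) have "i \<le> m" by (auto simp: sorted_append)
      with lt[of m] m show False by auto
    qed
  qed
  then show ?thesis by blast
qed

section \<open>Degrees along paths\<close>

lemma morse_digraph_edge_cases:
  assumes "(u, w, v) \<in> morse_digraph"
  obtains (down) "(u, w, v) \<in> bar_digraph" "(u, v) \<notin> matching" "length u = Suc (length v)"
    | (up) w' where "(v, w', u) \<in> bar_digraph" "(v, u) \<in> matching" "w = - unit_inverse w'"
      "length v = Suc (length u)"
  using assms unfolding morse_digraph_def reverse_along_def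
  by (auto dest: length_bar_digraph_edge)

text \<open>A reversed edge raises the degree by one but ends in \<open>Domain matching\<close>,
  where no reversed edge starts; every other edge lowers the degree. The two bounds need each other
  in the induction.\<close>

lemma length_dpath:
  assumes "dpath morse_digraph u es v"
  shows "length v \<le> Suc (length u)" "u \<notin> Range matching \<Longrightarrow> length v \<le> length u"
proof -
  have "length v \<le> Suc (length u) \<and> (u \<notin> Range matching \<longrightarrow> length v \<le> length u)"
    using assms
  proof (induction es arbitrary: u)
    case (Cons e es)
    then obtain w u' where "e = (u, w, u')" and e: "(u, w, u') \<in> morse_digraph" "dpath morse_digraph u' es v"
      by (cases e) auto
    note IH = Cons.IH[OF e(2)]
    from e(1) show ?case
    proof (cases rule: morse_digraph_edge_cases)
      case up
      then have "u' \<notin> Range matching" using Domain_matching_Int_Range by blast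
      with IH up show ?thesis by auto
    qed (use IH in auto)
  qed simp
  then show "length v \<le> Suc (length u)" "u \<notin> Range matching \<Longrightarrow> length v \<le> length u" by auto
qed

text \<open>A reversed edge ends in \<open>Domain matching\<close>, so it cannot be the last edge.
  Each reversed edge is therefore followed by a descending one, and the degree strictly drops unless
  the path begins with a reversed edge.\<close>

lemma length_dpath_to_unmatched:
  assumes "dpath morse_digraph u es v" "es \<noteq> []" "v \<notin> Domain matching"
  shows "length v \<le> length u \<and> (u \<notin> Range matching \<longrightarrow> length v < length u)"
  using assms(1,2)
proof (induction es arbitrary: u)
  case (Cons e es)
  then obtain w u' where "e = (u, w, u')" and e: "(u, w, u') \<in> morse_digraph" "dpath morse_digraph u' es v"
    by (cases e) auto
  show ?case
  proof (cases "es = []")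
    case True
    with e have "u' = v" by simp
    from e(1) show ?thesis
      by (cases rule: morse_digraph_edge_cases) (use assms(3) \<open>u' = v\<close> in auto)
  next
    case False
    note IH = Cons.IH[OF e(2) False]
    from e(1) show ?thesis
    proof (cases rule: morse_digraph_edge_cases)
      case up
      then have "u' \<notin> Range matching" using Domain_matching_Int_Range by blast
      with IH up show ?thesis by auto
    qed (use IH in auto)
  qed
qed simp

section \<open>Paths of swaps\<close>

text \<open>Down by multiplying \<open>a\<close> and \<open>b\<close>, then up by splitting off the
  maximum of \<open>{a, b}\<close>. For \<open>a < b\<close> the matching edge from
  \<open>b, a\<close> has weight \<open>(- 1) ^ length us\<close>, and the negated inverse shifts
  the exponent by one. The two weights agree and have product 1.\<close>

definition swap_edges ::
  "'n::{finite,linorder} list \<Rightarrow> 'n \<Rightarrow> 'n \<Rightarrow> 'n list \<Rightarrow>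
    ('n set list \<times> ('n, 'r::comm_ring_1) env \<times> 'n set list) list"
  where "swap_edges us a b vs =
    [(singletons (us @ [a, b] @ vs), (- 1) ^ Suc (length us), merged_word us a b vs),
     (merged_word us a b vs, (- 1) ^ Suc (length us), singletons (us @ [b, a] @ vs))]"

text \<open>Swaps are added at the end, so that induction peels off the last one, which created the
  first descent of the final word. Sortedness of \<open>us @ [b]\<close> is the condition of the
  matching.\<close>

inductive swap_path ::
  "'n::{finite,linorder} list \<Rightarrow> ('n set list \<times> ('n, 'r::comm_ring_1) env \<times> 'n set list) list \<Rightarrow>
    'n list \<Rightarrow> bool"
  for js
  where
    refl: "swap_path js [] js"
  | step: "swap_path js es (us @ [a, b] @ vs) \<Longrightarrow> a < b \<Longrightarrow> sorted (us @ [b]) \<Longrightarrow>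
      swap_path js (es @ swap_edges us a b vs) (us @ [b, a] @ vs)"

lemma unit_inverse_sign: "unit_inverse ((- 1) ^ k) = ((- 1) ^ k :: 'e::ring_1)"
proof -
  have sq: "(- 1) ^ k * (- 1) ^ k = (1 :: 'e)" by (simp flip: power_add mult_2)
  show ?thesis
    unfolding unit_inverse_def
    by (rule the_equality) (use sq in \<open>auto, metis mult.assoc mult_1_left mult_1_right\<close>)
qed

lemma swap_matching:
  assumes "a < b" "sorted (us @ [b])"
  shows "(singletons (us @ [b, a] @ vs), merged_word us a b vs) \<in> matching"
proof -
  have "{a, b} - {b} = {a}" "Max {a, b} = b" "card {a, b} = 2" using assms(1) by auto
  then show ?thesis
    unfolding matching_def using assms(2)
    by (intro CollectI exI[of _ us] exI[of _ b] exI[of _ "{a, b}"] exI[of _ "singletons vs"]) auto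
qed

lemma singletons_in_bar_words: "singletons js \<in> bar_words"
  by (auto simp: bar_words_def bar_basis_def)

text \<open>A sign is nonzero because \<open>env\<close> is a nontrivial ring, so the edge exists
  over every ground ring.\<close>

lemma bar_digraph_merge:
  fixes us :: "'n::{finite,linorder} list"
  assumes "a \<noteq> b"
  shows "(singletons (us @ [a, b] @ vs), w, merged_word us a b vs) \<in> bar_digraph \<longleftrightarrow>
    w = (- 1) ^ Suc (length us) * (if a < b then 1 else - 1 :: ('n, 'r::comm_ring_1) env)"
proof -
  have "(- 1) ^ k \<noteq> (0 :: ('n, 'r) env)" for k :: nat
    by (cases "even k") auto
  moreover have "merged_word us a b vs \<in> bar_words" by (auto simp: bar_words_def bar_basis_def)
  ultimately show ?thesis
    unfolding bar_digraph_def using singletons_in_bar_words[of "us @ [a, b] @ vs"]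
      boundary_merged_word[OF assms, of us vs, where 'r = 'r] by auto
qed

lemma swap_edges_in_morse_digraph:
  assumes "a < b" "sorted (us @ [b])"
  shows "dpath morse_digraph (singletons (us @ [a, b] @ vs)) (swap_edges us a b vs)
    (singletons (us @ [b, a] @ vs))"
proof -
  let ?s = "(- 1) ^ Suc (length us)"
  \<comment> \<open>A matching edge into the merged word starts with the maximum \<open>b\<close>
    split off first, not \<open>a\<close>; this edge is thus not reversed.\<close>
  have "(singletons (us @ [a, b] @ vs), merged_word us a b vs) \<notin> matching"
  proof
    assume "(singletons (us @ [a, b] @ vs), merged_word us a b vs) \<in> matching"
    then obtain ps i \<sigma> \<rho> where *:
      "singletons (us @ [a, b] @ vs) = singletons (ps @ [i]) @ (\<sigma> - {i}) # \<rho>"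
      "merged_word us a b vs = singletons ps @ \<sigma> # \<rho>" "i = Max \<sigma>" "\<And>j. \<sigma> \<noteq> {j}"
      by (rule matchingE) blast
    have "{a, b} \<noteq> {j}" for j using assms(1) by auto
    from first_nonsingleton_unique[OF _ this *(4), of us "singletons vs" ps \<rho>] *(2)
    have "us = ps" "\<sigma> = {a, b}" by auto
    with *(1,3) assms(1) show False by auto
  qed
  moreover have "(singletons (us @ [a, b] @ vs), ?s, merged_word us a b vs) \<in> bar_digraph"
    using assms(1) by (subst bar_digraph_merge) auto
  ultimately have "(singletons (us @ [a, b] @ vs), ?s, merged_word us a b vs) \<in> morse_digraph"
    unfolding morse_digraph_def reverse_along_def by auto
  moreover
  have "(singletons (us @ [b, a] @ vs), - ?s, merged_word us b a vs) \<in> bar_digraph"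
    using assms(1) by (subst bar_digraph_merge) auto
  then have "(singletons (us @ [b, a] @ vs), (- 1) ^ length us, merged_word us a b vs) \<in> bar_digraph"
    by (simp add: insert_commute)
  with swap_matching[OF assms, of vs]
  have "(merged_word us a b vs, - unit_inverse ((- 1) ^ length us), singletons (us @ [b, a] @ vs))
      \<in> morse_digraph"
    unfolding morse_digraph_def reverse_along_def by blast
  then have "(merged_word us a b vs, ?s, singletons (us @ [b, a] @ vs)) \<in> morse_digraph"
    by (simp add: unit_inverse_sign)
  ultimately show ?thesis by (simp add: swap_edges_def)
qed

lemma dpath_append: "dpath G u (es @ fs) w \<longleftrightarrow> (\<exists>v. dpath G u es v \<and> dpath G v fs w)"
  by (induction es arbitrary: u) auto

lemma swap_path_dpath:
  "swap_path js es ks \<Longrightarrow> dpath morse_digraph (singletons js) es (singletons ks)"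
proof (induction rule: swap_path.induct)
  case (step es us a b vs)
  with swap_edges_in_morse_digraph[OF step.hyps(2,3)] show ?case unfolding dpath_append by blast
qed simp

lemma mset_swap_path: "swap_path js es ks \<Longrightarrow> mset ks = mset js"
  by (induction rule: swap_path.induct) (auto simp: add_mset_commute)

lemma path_weight_swap_path: "swap_path js es ks \<Longrightarrow> path_weight es = 1"
proof (induction rule: swap_path.induct)
  case (step es us a b vs)
  have "path_weight (swap_edges us a b vs :: ('a set list \<times> ('a, 'b) env \<times> _) list) = 1"
    by (simp add: path_weight_def swap_edges_def flip: power_add mult_2)
  with step.IH show ?case by (simp add: path_weight_def)
qed (simp add: path_weight_def)

text \<open>The first edge descends, since no reversed edge leaves a word of singletons. The second
  must be reversed to regain the degree, so the word between them is a shorter end of the matching,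
  hence a merged word, and it determines the way up.\<close>

lemma first_two_edges:
  fixes es :: "('n::{finite,linorder} set list \<times> ('n, 'r::comm_ring_1) env \<times> 'n set list) list"
  assumes "dpath morse_digraph (singletons js) es v" "length v = length js" "es \<noteq> []"
  obtains us a b vs fs where "js = us @ [a, b] @ vs" "a < b" "sorted (us @ [b])"
    "es = swap_edges us a b vs @ fs" "dpath morse_digraph (singletons (us @ [b, a] @ vs)) fs v"
proof -
  from assms obtain w u fs where es: "es = (singletons js, w, u) # fs"
      "(singletons js, w, u) \<in> morse_digraph" "dpath morse_digraph u fs v"
    by (cases es) auto
  from es(2) have d1: "(singletons js, w, u) \<in> bar_digraph" "(singletons js, u) \<notin> matching"
      "length js = Suc (length u)"
    by (cases rule: morse_digraph_edge_cases; use singletons_notin_Range_matching[of js] in auto)+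
  with es(3) assms(2) obtain x u' fs' where fs: "fs = (u, x, u') # fs'"
      "(u, x, u') \<in> morse_digraph" "dpath morse_digraph u' fs' v"
    by (cases fs) auto
  \<comment> \<open>A second descent would leave the path two degrees too low, and only one degree
    can be regained.\<close>
  from fs(2) length_dpath(1)[OF fs(3)] d1(3) assms(2)
  obtain x' where up: "(u', x', u) \<in> bar_digraph" "(u', u) \<in> matching" "x = - unit_inverse x'"
    by (cases rule: morse_digraph_edge_cases) auto
  have "Poly_Mapping.lookup (bar_boundary
      (Poly_Mapping.single (singletons js) (1 :: ('n, 'r) env))) u \<noteq> 0"
    using d1(1) by (auto simp: bar_digraph_def)
  then obtain us a b vs where js: "js = us @ [a, b] @ vs" "a \<noteq> b" "u = merged_word us a b vs"
  proof (cases rule: boundary_singletons_cases)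
    case (1 ks)
    with up(2) singletons_notin_Range_matching[of ks] show ?thesis by blast
  qed blast
  from up(2) obtain ps i \<sigma> \<rho> where m: "u' = singletons (ps @ [i]) @ (\<sigma> - {i}) # \<rho>"
      "u = singletons ps @ \<sigma> # \<rho>" "i = Max \<sigma>" "sorted (ps @ [i])" "\<And>j. \<sigma> \<noteq> {j}"
    by (rule matchingE) blast
  have "{a, b} \<noteq> {j}" for j using js(2) by auto
  from first_nonsingleton_unique[OF _ this m(5), of us "singletons vs" ps \<rho>] m(2) js(3)
  have eq: "ps = us" "\<sigma> = {a, b}" "\<rho> = singletons vs" by auto
  \<comment> \<open>If \<open>b < a\<close>, then \<open>a\<close> is the maximum that the matching
    splits off, and the descending edge would itself be a matching edge, which is present only in
    reversed form.\<close>
  have lt: "a < b"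
  proof (rule ccontr)
    assume "\<not> a < b"
    with js(2) have "b < a" by simp
    with m(3,4) eq have "sorted (us @ [a])" by (simp add: max_def split: if_splits)
    from swap_matching[OF \<open>b < a\<close> this, of vs] js d1(2) show False
      by (simp add: insert_commute)
  qed
  then have i: "i = b" "{a, b} - {b} = {a}" using m(3) eq by auto
  have u': "u' = singletons (us @ [b, a] @ vs)" using m(1) eq i by simp
  have w: "w = (- 1) ^ Suc (length us)"
    using d1(1) lt bar_digraph_merge[OF js(2), of us vs w] js by simp
  have "x' = (- 1) ^ length us"
    using up(1) less_imp_not_less[OF lt] bar_digraph_merge[OF js(2)[symmetric], of us vs x'] js u'
    by (auto simp: insert_commute)
  then have "x = (- 1) ^ Suc (length us)" using up(3) by (simp add: unit_inverse_sign)
  with es(1) fs(1) w u' js have "es = swap_edges us a b vs @ fs'"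
    by (simp only: swap_edges_def append_Cons append_Nil)
  moreover have "sorted (us @ [b])" using m(4) eq(1) i(1) by simp
  ultimately show ?thesis using that js(1) lt fs(3) unfolding u' by blast
qed

text \<open>\<open>first_two_edges\<close> consumes a path from the left while
  \<open>swap_path\<close> grows on the right; the prefix \<open>es\<close> accumulates the swaps
  already found.\<close>

lemma dpath_imp_swap_path:
  assumes "swap_path js es ks" "dpath morse_digraph (singletons ks) fs v" "length v = length ks"
  shows "\<exists>ls. v = singletons ls \<and> swap_path js (es @ fs) ls"
  using assms
proof (induction "length fs" arbitrary: fs es ks rule: less_induct)
  case less
  show ?case
  proof (cases "fs = []")
    case True
    with less.prems show ?thesis by auto
  next
    case False
    from first_two_edges[OF less.prems(2,3) False] obtain us a b vs gs where *:
      "ks = us @ [a, b] @ vs" "a < b" "sorted (us @ [b])" "fs = swap_edges us a b vs @ gs"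
      "dpath morse_digraph (singletons (us @ [b, a] @ vs)) gs v" by blast
    have "swap_path js (es @ swap_edges us a b vs) (us @ [b, a] @ vs)"
      using less.prems(1) *(2,3) unfolding *(1) by (rule swap_path.step)
    from less.hyps[OF _ this *(5)] * less.prems(3) show ?thesis by (auto simp: swap_edges_def)
  qed
qed

section \<open>First descents and the unique path of swaps\<close>

text \<open>Sortedness of \<open>us @ [b]\<close> rules out any earlier descent, so both
  decompositions cut at the first one.\<close>

lemma first_descent_unique:
  fixes us :: "'a::linorder list"
  assumes "us @ [b, a] @ vs = us' @ [b', a'] @ vs'" "a < b" "a' < b'"
    "sorted (us @ [b])" "sorted (us' @ [b'])"
  shows "us = us' \<and> b = b' \<and> a = a' \<and> vs = vs'"
  using assms
proof (induction us arbitrary: us')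
  case Nil
  show ?case
  proof (cases us')
    case (Cons c cs)
    with Nil show ?thesis by (cases cs) auto
  qed (use Nil in auto)
next
  case (Cons u us)
  show ?case
  proof (cases us')
    case Nil
    with Cons.prems show ?thesis by (cases us) auto
  next
    case us': (Cons c cs)
    with Cons.prems have "u = c" "us @ [b, a] @ vs = cs @ [b', a'] @ vs'"
      "sorted (us @ [b])" "sorted (cs @ [b'])" by auto
    with Cons.IH[of cs] Cons.prems(2,3) us' show ?thesis by blast
  qed
qed

text \<open>The last swap is the first descent of the final word and can be read off it. The empty
  path ends in the sorted word \<open>js\<close>, which has no descent, so the two cases do not
  mix.\<close>

lemma swap_path_unique:
  assumes "swap_path js es ks" "swap_path js fs ks" "sorted js"
  shows "es = fs"
  using assms(1,2)
proof (induction arbitrary: fs rule: swap_path.induct)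
  case refl
  then show ?case using assms(3) by cases (auto simp: sorted_append)
next
  case (step es us a b vs)
  from step.prems show ?case
  proof cases
    case refl
    with assms(3) step.hyps show ?thesis by (auto simp: sorted_append)
  next
    case (step fs' us' a' b' vs')
    from first_descent_unique[OF step(2) \<open>a < b\<close> \<open>a' < b'\<close>] step \<open>sorted (us @ [b])\<close>
    have "us = us'" "b = b'" "a = a'" "vs = vs'" by auto
    with step step.IH show ?thesis by auto
  qed
qed

lemma first_descent_exists:
  fixes ks :: "'a::linorder list"
  assumes "\<not> sorted ks"
  shows "\<exists>us b a vs. ks = us @ [b, a] @ vs \<and> a < b \<and> sorted (us @ [b])"
  using assms
proof (induction ks rule: rev_induct)
  case (snoc x ks)
  show ?case
  proof (cases "sorted ks")
    case True
    with snoc.prems have "ks \<noteq> []" by auto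
    then obtain us b where us: "ks = us @ [b]" by (metis rev_exhaust)
    with True snoc.prems have "x < b" by (auto simp: sorted_append)
    with True us show ?thesis by (intro exI[of _ us] exI[of _ b] exI[of _ x] exI[of _ "[]"]) auto
  next
    case False
    from snoc.IH[OF this] show ?thesis by (metis append.assoc)
  qed
qed simp

text \<open>Undoing the first descent keeps the length and makes the word lexicographically smaller,
  which terminates because the alphabet is finite. It stops at a sorted rearrangement, which is
  \<open>js\<close>.\<close>

lemma swap_path_exists:
  fixes js ks :: "'n::{finite,linorder} list"
  assumes "sorted js" "mset ks = mset js"
  shows "\<exists>es :: ('n set list \<times> ('n, 'r::comm_ring_1) env \<times> 'n set list) list. swap_path js es ks"
proof -
  have "trans {(x :: 'n, y). x < y}" by (auto intro: transI)
  then have "wf {(x :: 'n, y). x < y}"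
    by (intro finite_acyclic_wf) (simp_all add: acyclic_def trancl_id)
  then have "wf (lenlex {(x :: 'n, y). x < y})" by (rule wf_lenlex)
  then show ?thesis using assms(2)
  proof (induction ks rule: wf_induct_rule)
    case (less ks)
    show ?case
    proof (cases "sorted ks")
      case True
      with assms(1) less.prems have "ks = js"
        by (metis properties_for_sort sorted_sort_id)
      then show ?thesis by (blast intro: swap_path.refl)
    next
      case False
      then obtain us b a vs where *: "ks = us @ [b, a] @ vs" "a < b" "sorted (us @ [b])"
        using first_descent_exists by blast
      then have "(us @ [a, b] @ vs, ks) \<in> lenlex {(x, y). x < y}"
        by (auto simp: lenlex_conv lex_conv)
      from less.IH[OF this] less.prems * obtain es ::
        "('n set list \<times> ('n, 'r) env \<times> 'n set list) list"
        where "swap_path js es (us @ [a, b] @ vs)" by (auto simp: add_mset_commute)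
      from swap_path.step[OF this *(2,3)] * show ?thesis by blast
    qed
  qed
qed

section \<open>The path sums and the induced maps\<close>

text \<open>Paths between words of equal degree starting at a critical word are paths of swaps:
  exactly one, of weight 1, to each rearrangement and none to other words.\<close>

lemma path_sum_from_critical:
  fixes \<tau> :: "'n::{finite,linorder} multiset"
  assumes "length v = size \<tau>"
  shows "path_sum morse_digraph (critical_word \<tau>) v =
    (if v \<in> singletons ` permutations_of_multiset \<tau> then 1 else 0 :: ('n, 'r::comm_ring_1) env)"
proof -
  let ?js = "sorted_list_of_multiset \<tau>"
  let ?P = "{es :: ('n set list \<times> ('n, 'r) env \<times> 'n set list) list.
    dpath morse_digraph (critical_word \<tau>) es v}"
  have len: "length v = length ?js" using assms by (metis mset_sorted_list_of_multiset size_mset)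
  have path: "\<exists>ls. v = singletons ls \<and> swap_path ?js es ls" if "es \<in> ?P" for es
    using dpath_imp_swap_path[OF swap_path.refl, of ?js es v] that len
    by (simp add: critical_word_def)
  show ?thesis
  proof (cases "v \<in> singletons ` permutations_of_multiset \<tau>")
    case True
    then obtain ks where ks: "v = singletons ks" "mset ks = mset ?js"
      by (auto dest: permutations_of_multisetD)
    then obtain es :: "('n set list \<times> ('n, 'r) env \<times> 'n set list) list"
      where es: "swap_path ?js es ks" using swap_path_exists[of ?js ks] by auto
    have "?P = {es}"
    proof
      show "{es} \<subseteq> ?P" using swap_path_dpath[OF es] ks(1) by (simp add: critical_word_def)
      show "?P \<subseteq> {es}"
      proof
        fix fs assume "fs \<in> ?P"
        from path[OF this] obtain ls where "singletons ks = singletons ls" "swap_path ?js fs ls"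
          using ks(1) by auto
        then have "swap_path ?js fs ks" by (metis (mono_tags) inj_map_eq_map inj_singleton)
        with es swap_path_unique show "fs \<in> {es}" by fastforce
      qed
    qed
    with True path_weight_swap_path[OF es] show ?thesis by (simp add: path_sum_def)
  next
    case False
    have "?P = {}"
      using path False by (fastforce dest: mset_swap_path intro: permutations_of_multisetI)
    with False show ?thesis unfolding path_sum_def by simp
  qed
qed

text \<open>A nonempty path from a word of singletons to a critical word loses degree, so only the
  empty path contributes.\<close>

lemma path_sum_to_critical:
  assumes "size \<tau> = length js"
  shows "path_sum morse_digraph (singletons js) (critical_word \<tau>) =
    (if js = sorted_list_of_multiset \<tau> then 1 else 0 :: ('n::{finite,linorder}, 'r::comm_ring_1) env)"
proof -
  have len: "length (critical_word \<tau>) = length js"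
    using assms by (metis critical_word_def length_map mset_sorted_list_of_multiset size_mset)
  have "es = []" if "dpath morse_digraph (singletons js) es (critical_word \<tau>)"
    for es :: "('n set list \<times> ('n, 'r) env \<times> 'n set list) list"
    using length_dpath_to_unmatched[OF that _ critical_word_notin_Domain_matching] len
      singletons_notin_Range_matching[of js] by fastforce
  then have "dpath morse_digraph (singletons js) es (critical_word \<tau>) \<longleftrightarrow>
      es = [] \<and> singletons js = critical_word \<tau>"
    for es :: "('n set list \<times> ('n, 'r) env \<times> 'n set list) list"
    by (metis dpath.simps(1))
  then have "{es :: ('n set list \<times> ('n, 'r) env \<times> 'n set list) list.
      dpath morse_digraph (singletons js) es (critical_word \<tau>)} =
    (if singletons js = critical_word \<tau> then {[]} else {})"
    by simp
  moreover have "singletons js = critical_word \<tau> \<longleftrightarrow> js = sorted_list_of_multiset \<tau>"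
    by (simp add: critical_word_def inj_map_eq_map)
  ultimately show ?thesis by (simp add: path_sum_def path_weight_def)
qed

lemma bar_tensor_singletons:
  fixes js :: "'n::{finite,linorder} list"
  shows "bar_tensor ([1] @ map ext_gen js @ [1]) =
    Poly_Mapping.single (singletons js) (1 :: ('n, 'r::comm_ring_1) env)"
proof -
  have "{} \<notin> set (singletons js)" by auto
  from bar_tensor_word_tensor[OF this, where 'r = 'r] show ?thesis
    by (simp add: word_tensor_def comp_def)
qed

theorem proposition2:
  fixes \<tau> :: "'n::{finite,linorder} multiset"
  shows "morse_h (Poly_Mapping.single \<tau> (1 :: ('n, 'r::comm_ring_1) env)) =
      (\<Sum>js\<in>permutations_of_multiset \<tau>. bar_tensor ([1] @ map ext_gen js @ [1])) \<and>
    (\<forall>js\<in>permutations_of_multiset \<tau>.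
      morse_h_inv (bar_tensor ([1] @ map ext_gen js @ [1])) =
      (if js = sorted_list_of_multiset \<tau>
       then Poly_Mapping.single \<tau> (1 :: ('n, 'r) env) else 0))"
proof (intro conjI ballI)
  let ?S = "singletons ` permutations_of_multiset \<tau>"
  have S: "?S \<subseteq> bar_basis (size \<tau>)"
    by (auto simp: bar_basis_def dest: permutations_of_multisetD)
  \<comment> \<open>Distinct rearrangements give distinct words, so the sum over words is a sum over
    rearrangements without repetition.\<close>
  have inj: "inj_on singletons (permutations_of_multiset \<tau>)"
    by (auto intro!: inj_onI simp: inj_map_eq_map)
  have "morse_h (Poly_Mapping.single \<tau> (1 :: ('n, 'r) env)) =
      (\<Sum>v\<in>bar_basis (size \<tau>). Poly_Mapping.single v (path_sum morse_digraph (critical_word \<tau>) v))"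
    by (simp add: morse_h_def)
  also have "\<dots> = (\<Sum>v\<in>bar_basis (size \<tau>). if v \<in> ?S then Poly_Mapping.single v 1 else 0)"
    by (intro sum.cong refl) (auto simp: path_sum_from_critical bar_basis_def)
  also have "\<dots> = (\<Sum>v\<in>?S. Poly_Mapping.single v 1)"
    using S by (simp add: sum.If_cases finite_bar_basis Int_absorb1)
  also have "\<dots> = (\<Sum>js\<in>permutations_of_multiset \<tau>. bar_tensor ([1] @ map ext_gen js @ [1]))"
    unfolding sum.reindex[OF inj] by (simp only: bar_tensor_singletons comp_def)
  finally show "morse_h (Poly_Mapping.single \<tau> (1 :: ('n, 'r) env)) =
    (\<Sum>js\<in>permutations_of_multiset \<tau>. bar_tensor ([1] @ map ext_gen js @ [1]))" .
next
  fix js assume "js \<in> permutations_of_multiset \<tau>"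
  then have \<tau>: "\<tau> = mset js" by (simp add: permutations_of_multiset_def)
  have "morse_h_inv (bar_tensor ([1] @ map ext_gen js @ [1])) =
      (\<Sum>\<tau>' | size \<tau>' = length js. Poly_Mapping.single \<tau>'
        (path_sum morse_digraph (singletons js) (critical_word \<tau>') :: ('n, 'r) env))"
    by (simp only: bar_tensor_singletons morse_h_inv_def lin_ext_single smult_simps length_map)
  \<comment> \<open>For \<tau>' other than \<open>mset js\<close> the sorted list of \<tau>' cannot
    be \<open>js\<close>, so only the term at \<tau> can survive.\<close>
  also have "\<dots> = (\<Sum>\<tau>' | size \<tau>' = length js. if \<tau>' = \<tau> then
      (if js = sorted_list_of_multiset \<tau> then Poly_Mapping.single \<tau> 1 else 0) else 0)"
    by (intro sum.cong refl) (auto simp: path_sum_to_critical \<tau>)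
  also have "\<dots> = (if js = sorted_list_of_multiset \<tau> then Poly_Mapping.single \<tau> 1 else 0)"
    by (simp add: finite_multisets_of_size \<tau>)
  finally show "morse_h_inv (bar_tensor ([1] @ map ext_gen js @ [1])) =
      (if js = sorted_list_of_multiset \<tau>
       then Poly_Mapping.single \<tau> (1 :: ('n, 'r) env) else 0)" .
qed

end
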